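(* Let $\lambda_{0},\lambda_{1}$ be real numbers with $\min\{\lambda_{0},\lambda_{1}\}>\frac{5+\sqrt{17}}{2}$. Then \[ 1+\frac{2}{\max\{\lambda_{0},\lambda_{1}\}}\;\geq\;\dim(\mathscr{W}_{\lambda_{0}}\times\mathscr{W}_{\lambda_{1}})\;\geq\;1=\max\Big\{1,\ \frac{2}{\lambda_{0}}+\frac{2}{\lambda_{1}}\Big\}. \] In particular, for every $\lambda\in\big(\frac{5+\sqrt{17}}{2},\infty\big]$ we have $\dim(\mathscr{W}_{\lambda}\times\mathscr{W}_{\lambda})\geq 1>2\dim(\mathscr{W}_{\lambda})$.
   Context: $\dim$ denotes Hausdorff dimension. For $\xi\in\mathbb{R}$, the irrationality exponent $\mu(\xi)$ is the supremum of all $\mu$ such that $|\xi-p/q|\leq q^{-\mu}$ has infinitely many rational solutions $p/q$ ($q\geq 1$). For $\lambda\in[2,\infty]$, $\mathscr{W}_{\lambda}=\{\xi\in\mathbb{R}:\mu(\xi)=\lambda\}$. *)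

theory Defs
  imports "HOL-Analysis.Analysis"
begin

section \<open>Hausdorff measure and Hausdorff dimension\<close>

text \<open>
  The weight of a covering set is its diameter to the power \<open>s\<close>, where the empty set has
  weight 0 and, for \<open>s = 0\<close>, every nonempty set has weight 1 (whereas \<open>0 powr 0 = 0\<close>).
\<close>

definition diameter_weight :: "real \<Rightarrow> 'a::metric_space set \<Rightarrow> ennreal" where
  "diameter_weight s U =
     (if U = {} then 0 else if s = 0 then 1 else ennreal (diameter U powr s))"

text \<open>
  Boundedness is required explicitly because \<^const>\<open>diameter\<close> is a real supremum, which
  is not meaningful for unbounded sets.  Finite covers are included by padding with \<open>{}\<close>.
\<close>

definition hausdorff_premeasure :: "real \<Rightarrow> real \<Rightarrow> 'a::metric_space set \<Rightarrow> ennreal" where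
  "hausdorff_premeasure s \<delta> A =
     Inf {(\<Sum>i. diameter_weight s (U i)) | U :: nat \<Rightarrow> 'a set.
            A \<subseteq> (\<Union>i. U i) \<and> (\<forall>i. bounded (U i) \<and> diameter (U i) \<le> \<delta>)}"

definition hausdorff_measure :: "real \<Rightarrow> 'a::metric_space set \<Rightarrow> ennreal" where
  "hausdorff_measure s A = (SUP \<delta>\<in>{0<..}. hausdorff_premeasure s \<delta> A)"

definition hausdorff_dim :: "'a::metric_space set \<Rightarrow> ereal" where
  "hausdorff_dim A = Inf {ereal s | s. 0 \<le> s \<and> hausdorff_measure s A = 0}"

section \<open>Irrationality exponent\<close>

text \<open>
  The rationals \<open>r = p/q\<close> are counted as numbers, so that non-reduced representations of one
  and the same rational do not count as different solutions.  The supremum is taken in the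
  extended reals, so it is \<open>\<infinity>\<close> exactly for Liouville numbers.
\<close>

definition irrationality_exponent :: "real \<Rightarrow> ereal" where
  "irrationality_exponent \<xi> =
     Sup {ereal \<mu> | \<mu>.
       infinite {r::real. \<exists>(p::int) (q::nat). 1 \<le> q \<and> r = of_int p / of_nat q \<and>
                                 \<bar>\<xi> - r\<bar> \<le> of_nat q powr (- \<mu>)}}"

definition W_set :: "ereal \<Rightarrow> real set" where
  "W_set l = {\<xi>. irrationality_exponent \<xi> = l}"

end

(*
  The upper bounds come from covering by the balls of radius q^-mu around the fractions p/q.

  The lower bound comes from sums.  Addition is Lipschitz, so a set A in the plane has dimension
  at least 1 as soon as {a + b | (a,b) in A} is not Lebesgue null.  Following Erdos, cut the binary
  expansion of x into blocks with endpoints n 0 < n 1 < ..., where n (j+1) / n j is alternately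
  close to l1 and l0, and give the blocks alternately to two numbers.  Their sum is x up to a
  constant, and truncating one of them before a run of zeros gives a fraction with denominator Q
  and error about Q^-l, where l is l0 for the one number and l1 for the other.  For almost all x
  no fraction does better.  If s^(7/2) >> Q and s << Q^(l-1), a fraction with denominator s that
  approximates within s^(-9/2) is so close to the truncation that it must equal it.  The remaining
  s are treated by Borel-Cantelli: on a dyadic cell of level n j the number is a translate of x up
  to an error of order 2^-n(j+1), so the x for which some fraction with such a denominator is that
  close have summable measure.  All this needs only n (j+1) >= 9/2 * n j, and
  9/2 < (5 + sqrt 17) / 2.
*)
theory Submission
  imports Defs "HOL-Real_Asymp.Real_Asymp"
begin

section \<open>Hausdorff measure: upper bounds from countable covers\<close>

lemma hausdorff_dim_le:
  "0 \<le> s \<Longrightarrow> hausdorff_measure s A = 0 \<Longrightarrow> hausdorff_dim A \<le> ereal s"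
  unfolding hausdorff_dim_def by (rule Inf_lower) auto

lemma hausdorff_premeasure_le:
  assumes "A \<subseteq> (\<Union>i. U i)" "\<And>i. bounded (U i)" "\<And>i. diameter (U i) \<le> \<delta>"
  shows "hausdorff_premeasure s \<delta> A \<le> (\<Sum>i. diameter_weight s (U i))"
  unfolding hausdorff_premeasure_def by (rule Inf_lower) (use assms in blast)

text \<open>The convergence half of Borel-Cantelli for Hausdorff measure: for every \<open>M\<close>
  the families \<open>V q\<close> with \<open>q \<ge> M\<close> together cover \<open>A\<close>, and
  their total weight is at most a tail of a convergent series.\<close>

lemma hausdorff_cantelli:
  fixes V :: "nat \<Rightarrow> 'a::metric_space set set" and N d :: "nat \<Rightarrow> real"
  assumes s: "s > 0" and fin: "\<And>q. finite (V q)" and card: "\<And>q. real (card (V q)) \<le> N q"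
    and V: "\<And>q U. U \<in> V q \<Longrightarrow> bounded U \<and> diameter U \<le> d q"
    and lim: "d \<longlonglongrightarrow> 0" and summ: "summable (\<lambda>q. N q * d q powr s)"
    and A: "\<And>x. x \<in> A \<Longrightarrow> infinite {q. x \<in> \<Union>(V q)}"
  shows "hausdorff_measure s A = 0"
proof -
  have "hausdorff_premeasure s \<delta> A \<le> ennreal e" if \<delta>: "\<delta> > 0" and e: "e > 0" for \<delta> e
  proof -
    obtain M1 where M1: "\<And>q. q \<ge> M1 \<Longrightarrow> d q < \<delta>"
      using order_tendstoD(2)[OF lim \<delta>] unfolding eventually_sequentially by blast
    obtain M2 where M2: "\<And>n. n \<ge> M2 \<Longrightarrow> norm (\<Sum>i. N (i+n) * d (i+n) powr s) < e"
      using suminf_exist_split[OF e summ] by blast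
    \<comment> \<open>\<open>M1\<close> controls the diameters, \<open>M2\<close> the tail of the
      series.\<close>
    define M where "M = max M1 M2"
    have "\<exists>h. bij_betw h {0..<card (V q)} (V q)" for q
      using ex_bij_betw_nat_finite[OF fin] by blast
    then obtain h where h: "\<And>q. bij_betw (h q) {0..<card (V q)} (V q)" by metis
    \<comment> \<open>Each finite family is enumerated and padded with \<open>{}\<close>, which has
      weight 0, so that the double family can be flattened with \<open>prod_decode\<close>.\<close>
    define W where "W q m = (if m < card (V (q+M)) then h (q+M) m else {})" for q m
    have W: "W q m = {} \<or> W q m \<in> V (q+M)" for q m
      using bij_betwE[OF h[of "q+M"]] by (auto simp: W_def)
    have Wd: "bounded (W q m) \<and> diameter (W q m) \<le> \<delta>" for q m
    proof -
      have "M1 \<le> q+M" by (simp add: M_def)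
      then have "d (q+M) \<le> \<delta>" using M1 less_imp_le by blast
      then show ?thesis using W[of q m] V[of "W q m" "q+M"] \<delta> by fastforce
    qed
    have N0: "0 \<le> N q" for q using card[of q] by (meson of_nat_0_le_iff order_trans)
    have sm: "(\<Sum>m. diameter_weight s (W q m)) \<le> ennreal (N (q+M) * d (q+M) powr s)" for q
    proof -
      have "(\<Sum>m. diameter_weight s (W q m)) = (\<Sum>m<card (V (q+M)). diameter_weight s (W q m))"
        by (rule suminf_finite) (auto simp: W_def diameter_weight_def)
      also have "\<dots> \<le> (\<Sum>m<card (V (q+M)). ennreal (d (q+M) powr s))"
      proof (rule sum_mono)
        fix m
        show "diameter_weight s (W q m) \<le> ennreal (d (q+M) powr s)"
          using W[of q m] V[of "W q m" "q+M"] s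
          by (auto simp: diameter_weight_def intro!: ennreal_leI powr_mono2 diameter_ge_0)
      qed
      also have "\<dots> = ennreal (card (V (q+M)) * d (q+M) powr s)"
        by (simp add: ennreal_mult ennreal_of_nat_eq_real_of_nat)
      also have "\<dots> \<le> ennreal (N (q+M) * d (q+M) powr s)"
        by (intro ennreal_leI mult_right_mono card) auto
      finally show ?thesis .
    qed
    define U where "U i = case_prod W (prod_decode i)" for i
    have "A \<subseteq> (\<Union>i. U i)"
    proof
      fix x assume "x \<in> A"
      then obtain q where q: "q > M" "x \<in> \<Union>(V q)"
        using A by (metis (mono_tags, lifting) infinite_nat_iff_unbounded mem_Collect_eq)
      then obtain X where "X \<in> h q ` {0..<card (V q)}" "x \<in> X"
        using h[of q] unfolding bij_betw_def by blast
      then obtain m where "m < card (V q)" "x \<in> h q m" by auto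
      then have "x \<in> W (q-M) m" using q by (simp add: W_def)
      then have "x \<in> U (prod_encode (q-M, m))" by (simp add: U_def)
      then show "x \<in> (\<Union>i. U i)" by blast
    qed
    then have "hausdorff_premeasure s \<delta> A \<le> (\<Sum>i. diameter_weight s (U i))"
      by (rule hausdorff_premeasure_le) (use Wd in \<open>auto simp: U_def split: prod.split\<close>)
    also have "\<dots> = (\<Sum>i. (\<lambda>(q,m). diameter_weight s (W q m)) (prod_decode i))"
      by (simp add: U_def case_prod_beta)
    also have "\<dots> = (\<Sum>q. \<Sum>m. diameter_weight s (W q m))"
      by (rule suminf_ennreal_2dimen) simp
    also have "\<dots> \<le> (\<Sum>q. ennreal (N (q+M) * d (q+M) powr s))"
      by (intro suminf_le sm) auto
    also have "\<dots> = ennreal (\<Sum>q. N (q+M) * d (q+M) powr s)"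
      by (rule suminf_ennreal2) (use N0 summable_ignore_initial_segment[OF summ, of M] in \<open>auto intro!: mult_nonneg_nonneg\<close>)
    also have "\<dots> \<le> ennreal e"
      using M2[of M] by (intro ennreal_leI) (auto simp: M_def)
    finally show ?thesis .
  qed
  then have "hausdorff_premeasure s \<delta> A = 0" if "\<delta> > 0" for \<delta>
    using that by (metis ennreal_le_epsilon add_0 le_zero_eq)
  then show ?thesis unfolding hausdorff_measure_def by (simp add: SUP_eq_const)
qed

section \<open>Rational approximants and the irrationality exponent\<close>

definition approximants :: "real \<Rightarrow> real \<Rightarrow> real set" where
  "approximants \<mu> \<xi> = {r. \<exists>(p::int) (q::nat). 1 \<le> q \<and> r = of_int p / of_nat q \<and>
                                 \<bar>\<xi> - r\<bar> \<le> of_nat q powr (- \<mu>)}"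

lemma irrationality_exponent_alt:
  "irrationality_exponent \<xi> = Sup {ereal \<mu> | \<mu>. infinite (approximants \<mu> \<xi>)}"
  by (simp add: irrationality_exponent_def approximants_def)

lemma approximants_antimono:
  assumes "\<mu> \<le> \<mu>'"
  shows "approximants \<mu>' \<xi> \<subseteq> approximants \<mu> \<xi>"
proof
  fix r assume "r \<in> approximants \<mu>' \<xi>"
  then obtain p :: int and q :: nat where pq: "1 \<le> q" "r = of_int p / of_nat q"
    "\<bar>\<xi> - r\<bar> \<le> of_nat q powr (- \<mu>')" unfolding approximants_def by blast
  have "real q powr (- \<mu>') \<le> real q powr (- \<mu>)" using pq assms by (intro powr_mono) auto
  then show "r \<in> approximants \<mu> \<xi>" unfolding approximants_def using pq by force
qed

text \<open>An error of at most 1 gives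
  \<open>\<bar>p\<bar> \<le> (\<bar>\<xi>\<bar> + 1) * B\<close>, so bounded denominators leave
  finitely many fractions.\<close>

lemma finite_approximants_bounded:
  assumes "\<And>(p::int) (q::nat). 1 \<le> q \<Longrightarrow> \<bar>\<xi> - p / q\<bar> \<le> real q powr (- \<mu>) \<Longrightarrow> q \<le> B" and "0 \<le> \<mu>"
  shows "finite (approximants \<mu> \<xi>)"
proof -
  define C :: int where "C = \<lceil>(\<bar>\<xi>\<bar> + 1) * B\<rceil>"
  have "approximants \<mu> \<xi> \<subseteq> (\<lambda>(p::int,q::nat). p / q) ` ({-C..C} \<times> {..B})"
  proof
    fix r assume "r \<in> approximants \<mu> \<xi>"
    then obtain p :: int and q :: nat where pq: "1 \<le> q" "r = of_int p / of_nat q"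
      "\<bar>\<xi> - r\<bar> \<le> of_nat q powr (- \<mu>)" unfolding approximants_def by blast
    have B: "q \<le> B" using assms(1) pq by blast
    have "real q powr (- \<mu>) \<le> real q powr 0" using pq assms by (intro powr_mono) auto
    then have "\<bar>r\<bar> \<le> \<bar>\<xi>\<bar> + 1" using pq by auto
    then have "\<bar>r\<bar> * q \<le> (\<bar>\<xi>\<bar> + 1) * B" using B by (intro mult_mono) auto
    moreover have "\<bar>r\<bar> * q = \<bar>p\<bar>" using pq by (simp add: abs_mult)
    ultimately have "\<bar>p\<bar> \<le> C" unfolding C_def by linarith
    then have "(p,q) \<in> {-C..C} \<times> {..B}" using B by auto
    then show "r \<in> (\<lambda>(p::int,q::nat). p / q) ` ({-C..C} \<times> {..B})" using pq by force
  qed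
  then show ?thesis by (rule finite_subset) auto
qed

text \<open>The supremum only supplies some larger exponent with infinitely many solutions;
  \<open>approximants_antimono\<close> carries this down to \<open>\<mu>\<close>.\<close>

lemma W_set_infinite_approximants:
  assumes "\<xi> \<in> W_set l" "ereal \<mu> < l"
  shows "infinite (approximants \<mu> \<xi>)"
proof -
  from assms have "ereal \<mu> < Sup {ereal \<mu> | \<mu>. infinite (approximants \<mu> \<xi>)}"
    by (simp add: W_set_def irrationality_exponent_alt)
  then obtain \<mu>' where "\<mu> < \<mu>'" "infinite (approximants \<mu>' \<xi>)"
    unfolding less_Sup_iff by auto
  then show ?thesis using approximants_antimono finite_subset by (metis less_imp_le)
qed

text \<open>Letting \<open>\<bar>p\<bar>\<close> grow like \<open>q powr (1 + \<eta>)\<close> keeps the number of fractions with denominator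
  \<open>q\<close> finite while still reaching all of the (unbounded) set \<^term>\<open>W_set l\<close>.\<close>

lemma W_set_infinite_denominators:
  assumes "\<xi> \<in> W_set l" "ereal \<mu> < l" "0 \<le> \<mu>" "0 < \<eta>"
  shows "infinite {q::nat. 1 \<le> q \<and> B \<le> real q powr \<eta> \<and>
     (\<exists>p::int. \<bar>p\<bar> \<le> real q powr (1 + \<eta>) \<and> \<bar>\<xi> - p / q\<bar> \<le> real q powr (- \<mu>))}" (is "infinite ?S")
proof
  assume "finite ?S"
  then obtain b where b: "\<And>q. q \<in> ?S \<Longrightarrow> q \<le> b" by (meson finite_nat_set_iff_bounded_le)
  have "filterlim (\<lambda>q. real q powr \<eta>) at_top sequentially"
    using assms(4) by real_asymp
  then have "\<forall>\<^sub>F q in sequentially. real q powr \<eta> \<ge> max B (\<bar>\<xi>\<bar> + 1)"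
    unfolding filterlim_at_top by blast
  then obtain M where M: "\<And>q. q \<ge> M \<Longrightarrow> real q powr \<eta> \<ge> max B (\<bar>\<xi>\<bar> + 1)"
    unfolding eventually_sequentially by blast
  have "finite (approximants \<mu> \<xi>)"
  proof (rule finite_approximants_bounded[where B = "max b M"])
    fix p :: int and q :: nat
    assume q: "1 \<le> q" and pq: "\<bar>\<xi> - p / q\<bar> \<le> real q powr (- \<mu>)"
    show "q \<le> max b M"
    proof (cases "q \<ge> M")
      case True
      have "real q powr (- \<mu>) \<le> real q powr 0" using q assms by (intro powr_mono) auto
      then have "\<bar>p / q\<bar> \<le> \<bar>\<xi>\<bar> + 1" using pq q by auto
      also have "\<dots> \<le> real q powr \<eta>" using M True by force
      finally have "\<bar>real_of_int p\<bar> \<le> q * real q powr \<eta>" using q by (simp add: field_simps)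
      also have "\<dots> = real q powr (1 + \<eta>)" using q by (simp add: powr_add)
      finally have "q \<in> ?S" using q pq M[OF True] by auto
      then show ?thesis using b by force
    qed simp
  qed (use assms in auto)
  then show False using W_set_infinite_approximants assms by blast
qed

section \<open>Upper bounds for the dimension of \<open>W_set l\<close> and of products\<close>

lemma card_int_symmetric_le:
  assumes "real_of_int c \<le> a" "0 \<le> a"
  shows "real (card {-c..c}) \<le> 2 * a + 1"
  using assms by (simp add: of_nat_nat)

text \<open>The easy half of the Jarnik-Besicovitch theorem: about
  \<open>q powr (1 + \<eta>)\<close> balls of radius \<open>q powr -\<mu>\<close> around the
  fractions with denominator \<open>q\<close> contribute
  \<open>q powr (1 + \<eta> - \<mu> * s)\<close>, up to a constant.\<close>

lemma hausdorff_dim_W_set_le: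
  assumes "ereal \<mu> < l" "0 < \<mu>" "2 / \<mu> < s"
  shows "hausdorff_dim (W_set l) \<le> ereal s"
proof -
  \<comment> \<open>Then \<open>\<mu> * s = 2 + 2 * \<eta>\<close>, so the series has terms of order
    \<open>q powr (- 1 - \<eta>)\<close>.\<close>
  define \<eta> where "\<eta> = (\<mu> * s - 2) / 2"
  have \<eta>: "\<eta> > 0" using assms by (simp add: \<eta>_def field_simps)
  have "0 < 2 / \<mu>" using assms by simp
  then have s: "s > 0" using assms by linarith
  define c where "c q = \<lfloor>real q powr (1 + \<eta>)\<rfloor>" for q
  define V where "V q = (if q = 0 then {} else
     (\<lambda>p::int. cball (p / real q) (real q powr -\<mu>)) ` {-c q..c q})" for q
  have "hausdorff_measure s (W_set l) = 0"
  proof (rule hausdorff_cantelli[where V = V and d = "\<lambda>q. 2 * real q powr -\<mu>" and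
        N = "\<lambda>q. 3 * real q powr (1 + \<eta>)"])
    show "finite (V q)" for q by (simp add: V_def)
    show "real (card (V q)) \<le> 3 * real q powr (1 + \<eta>)" for q
    proof (cases "q = 0")
      case False
      have "1 \<le> real q powr (1 + \<eta>)" using False \<eta> by (intro ge_one_powr_ge_zero) auto
      moreover have "real (card (V q)) \<le> card {-c q..c q}"
        using False unfolding V_def if_not_P[OF False] by (intro of_nat_mono card_image_le) simp
      moreover have "real (card {-c q..c q}) \<le> 2 * real q powr (1 + \<eta>) + 1"
        by (rule card_int_symmetric_le) (auto simp: c_def)
      ultimately show ?thesis by linarith
    qed (simp add: V_def)
    show "bounded U \<and> diameter U \<le> 2 * real q powr - \<mu>" if "U \<in> V q" for U q
      using that by (auto simp: V_def diameter_cball split: if_splits)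
    show "(\<lambda>q. 2 * real q powr - \<mu>) \<longlonglongrightarrow> 0"
      using assms(2) by real_asymp
    have eq: "3 * real q powr (1 + \<eta>) * (2 * real q powr - \<mu>) powr s
        = (3 * 2 powr s) * real q powr (- 1 - \<eta>)" for q
    proof -
      have "\<mu> * s = 2 + 2 * \<eta>" by (simp add: \<eta>_def field_simps)
      then have "real q powr (1 + \<eta>) * real q powr (- (\<mu> * s)) = real q powr (- 1 - \<eta>)"
        unfolding powr_add[symmetric] by (intro arg_cong[where f = "(powr) (real q)"]) linarith
      then show ?thesis by (simp add: powr_mult powr_powr)
    qed
    show "summable (\<lambda>q. 3 * real q powr (1 + \<eta>) * (2 * real q powr - \<mu>) powr s)"
      unfolding eq using \<eta> by (intro summable_mult) (simp add: summable_real_powr_iff)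
    show "infinite {q. x \<in> \<Union> (V q)}" if "x \<in> W_set l" for x
    proof (rule infinite_super[OF _ W_set_infinite_denominators[OF that assms(1) _ \<eta>, where B = 0]])
      show "{q. 1 \<le> q \<and> 0 \<le> real q powr \<eta> \<and> (\<exists>p::int. \<bar>p\<bar> \<le> real q powr (1 + \<eta>) \<and> \<bar>x - p / q\<bar> \<le> real q powr - \<mu>)}
        \<subseteq> {q. x \<in> \<Union> (V q)}"
      proof clarsimp
        fix q p assume q: "Suc 0 \<le> q" and p: "\<bar>real_of_int p\<bar> \<le> real q powr (1 + \<eta>)"
          "\<bar>x - real_of_int p / real q\<bar> \<le> real q powr - \<mu>"
        have "\<bar>p\<bar> \<le> c q" unfolding c_def using p(1) by linarith
        then show "\<exists>U\<in>V q. x \<in> U"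
          using q p by (auto simp: V_def dist_real_def abs_minus_commute intro!: bexI[of _ p])
      qed
    qed (use assms in auto)
  qed (use s in auto)
  then show ?thesis using s by (intro hausdorff_dim_le) auto
qed

text \<open>The strip around \<open>p / q\<close> is cut along \<open>h\<close> into boxes of size
  about \<open>q powr -\<mu>\<close>. Heights up to \<open>q powr \<eta>\<close> need about
  \<open>q powr (\<eta> + \<mu>)\<close> boxes, which raises the critical exponent by 1. Abstract
  coordinates \<open>g\<close> and \<open>h\<close> allow either factor of a product to be the
  approximated one.\<close>

lemma hausdorff_dim_fibred_over_W_set_le:
  fixes A :: "'a::metric_space set" and g h :: "'a \<Rightarrow> real"
  assumes dist: "\<And>z w. dist z w \<le> \<bar>g z - g w\<bar> + \<bar>h z - h w\<bar>"
    and A: "\<And>z. z \<in> A \<Longrightarrow> g z \<in> W_set l"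
    and "ereal \<mu> < l" "0 < \<mu>" "1 + 2 / \<mu> < s"
  shows "hausdorff_dim A \<le> ereal s"
proof -
  \<comment> \<open>Then \<open>\<mu> * s = 2 + \<mu> + 3 * \<eta>\<close>: one
    \<open>\<eta>\<close> pays for the numerators, one for the heights, and one is left for
    convergence.\<close>
  define \<eta> where "\<eta> = (\<mu> * (s - 1) - 2) / 3"
  have \<eta>: "\<eta> > 0" using assms by (simp add: \<eta>_def field_simps)
  have "0 < 2 / \<mu>" using assms by simp
  then have s: "s > 0" using assms by linarith
  define c where "c q = \<lfloor>real q powr (1 + \<eta>)\<rfloor>" for q
  define e where "e q = \<lceil>real q powr (\<eta> + \<mu>)\<rceil>" for q
  define box where "box q = (\<lambda>(p::int, m::int). {z. \<bar>g z - p / real q\<bar> \<le> real q powr -\<mu> \<and>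
     m * real q powr -\<mu> \<le> h z \<and> h z \<le> (m + 1) * real q powr -\<mu>})" for q
  define V where "V q = (if q = 0 then {} else box q ` ({-c q..c q} \<times> {-e q..e q}))" for q
  have "hausdorff_measure s A = 0"
  proof (rule hausdorff_cantelli[where V = V and d = "\<lambda>q. 3 * real q powr -\<mu>" and
        N = "\<lambda>q. (3 * real q powr (1 + \<eta>)) * (5 * real q powr (\<eta> + \<mu>))"])
    show "finite (V q)" for q by (simp add: V_def)
    show "real (card (V q)) \<le> (3 * real q powr (1 + \<eta>)) * (5 * real q powr (\<eta> + \<mu>))" for q
    proof (cases "q = 0")
      case False
      have c1: "1 \<le> real q powr (1 + \<eta>)" using False \<eta> by (intro ge_one_powr_ge_zero) auto
      have e1: "1 \<le> real q powr (\<eta> + \<mu>)" using False \<eta> assms by (intro ge_one_powr_ge_zero) auto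
      have "real (card (V q)) \<le> real (card ({-c q..c q} \<times> {-e q..e q}))"
        using False unfolding V_def if_not_P[OF False] by (intro of_nat_mono card_image_le) simp
      also have "\<dots> = real (card {-c q..c q}) * real (card {-e q..e q})"
        by (simp only: card_cartesian_product of_nat_mult)
      also have "\<dots> \<le> (2 * real q powr (1 + \<eta>) + 1) * (2 * (real q powr (\<eta> + \<mu>) + 1) + 1)"
        unfolding c_def e_def by (intro mult_mono card_int_symmetric_le) auto
      also have "\<dots> \<le> (3 * real q powr (1 + \<eta>)) * (5 * real q powr (\<eta> + \<mu>))"
        using c1 e1 by (intro mult_mono) auto
      finally show ?thesis .
    qed (simp add: V_def)
    show "bounded U \<and> diameter U \<le> 3 * real q powr - \<mu>" if "U \<in> V q" for U q
    proof -
      from that obtain p m :: int where U: "U = box q (p,m)" by (auto simp: V_def split: if_splits)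
      \<comment> \<open>In a box \<open>g\<close> varies by at most twice
        \<open>q powr -\<mu>\<close> and \<open>h\<close> by at most once.\<close>
      have d: "dist z w \<le> 3 * real q powr -\<mu>" if "z \<in> U" "w \<in> U" for z w
        using dist[of z w] that unfolding U box_def by (auto simp: algebra_simps abs_if split: if_splits)
      have "diameter U \<le> 3 * real q powr -\<mu>"
        using d unfolding diameter_def by (auto intro!: cSUP_least)
      moreover have "bounded U"
        using d unfolding bounded_def by (cases "U = {}") blast+
      ultimately show ?thesis by blast
    qed
    show "(\<lambda>q. 3 * real q powr - \<mu>) \<longlonglongrightarrow> 0"
      using assms(4) by real_asymp
    have eq: "(3 * real q powr (1 + \<eta>)) * (5 * real q powr (\<eta> + \<mu>)) * (3 * real q powr - \<mu>) powr s
        = (15 * 3 powr s) * real q powr (- 1 - \<eta>)" for q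
    proof -
      have "\<mu> * s = 2 + \<mu> + 3 * \<eta>" by (simp add: \<eta>_def field_simps)
      then have "real q powr (1 + \<eta>) * real q powr (\<eta> + \<mu>) * real q powr (- (\<mu> * s)) = real q powr (- 1 - \<eta>)"
        unfolding powr_add[symmetric] by (intro arg_cong[where f = "(powr) (real q)"]) linarith
      then show ?thesis by (simp add: powr_mult powr_powr)
    qed
    show "summable (\<lambda>q. (3 * real q powr (1 + \<eta>)) * (5 * real q powr (\<eta> + \<mu>)) * (3 * real q powr - \<mu>) powr s)"
      unfolding eq using \<eta> by (intro summable_mult) (simp add: summable_real_powr_iff)
    show "infinite {q. x \<in> \<Union> (V q)}" if x: "x \<in> A" for x
    \<comment> \<open>Taking \<open>B = \<bar>h x\<bar>\<close> keeps only denominators whose boxes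
      reach the height of \<open>x\<close>.\<close>
    proof (rule infinite_super[OF _ W_set_infinite_denominators[OF A[OF x] assms(3) _ \<eta>, where B = "\<bar>h x\<bar>"]])
      show "{q. 1 \<le> q \<and> \<bar>h x\<bar> \<le> real q powr \<eta> \<and>
          (\<exists>p::int. \<bar>p\<bar> \<le> real q powr (1 + \<eta>) \<and> \<bar>g x - p / q\<bar> \<le> real q powr - \<mu>)}
        \<subseteq> {q. x \<in> \<Union> (V q)}"
      proof clarsimp
        fix q p assume q: "Suc 0 \<le> q" and hx: "\<bar>h x\<bar> \<le> real q powr \<eta>"
          and p: "\<bar>real_of_int p\<bar> \<le> real q powr (1 + \<eta>)"
          "\<bar>g x - real_of_int p / real q\<bar> \<le> real q powr - \<mu>"
        have pc: "\<bar>p\<bar> \<le> c q" unfolding c_def using p(1) by linarith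
        define m where "m = \<lfloor>h x * real q powr \<mu>\<rfloor>"
        have inv: "real q powr \<mu> * real q powr -\<mu> = 1" using q by (simp flip: powr_add)
        have "\<bar>h x * real q powr \<mu>\<bar> \<le> real q powr \<eta> * real q powr \<mu>"
          using hx by (simp add: abs_mult mult_right_mono)
        then have "\<bar>h x * real q powr \<mu>\<bar> \<le> real q powr (\<eta> + \<mu>)" by (simp add: powr_add)
        then have me: "\<bar>m\<bar> \<le> e q" unfolding m_def e_def by linarith
        have "m \<le> h x * real q powr \<mu>" "h x * real q powr \<mu> \<le> m + 1" unfolding m_def by linarith+
        then have "m * real q powr -\<mu> \<le> h x * real q powr \<mu> * real q powr -\<mu>"
          "h x * real q powr \<mu> * real q powr -\<mu> \<le> (m + 1) * real q powr -\<mu>"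
          by (intro mult_right_mono; simp)+
        then have "m * real q powr -\<mu> \<le> h x" "h x \<le> (m + 1) * real q powr -\<mu>"
          using inv by (simp_all add: mult.assoc)
        then have "x \<in> box q (p, m)" using p by (simp add: box_def)
        moreover have "box q (p, m) \<in> V q"
          using q pc me by (auto simp: V_def intro!: imageI)
        ultimately show "\<exists>U\<in>V q. x \<in> U" by blast
      qed
    qed (use assms in auto)
  qed (use s in auto)
  then show ?thesis using s by (intro hausdorff_dim_le) auto
qed

text \<open>The limit \<open>\<mu>\<close> to \<open>l\<close> from the left, by continuity of
  \<open>2 / \<mu>\<close>.\<close>

lemma hausdorff_dim_fibred_over_W_set_le':
  fixes A :: "'a::metric_space set" and g h :: "'a \<Rightarrow> real"
  assumes "\<And>z w. dist z w \<le> \<bar>g z - g w\<bar> + \<bar>h z - h w\<bar>"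
    and "\<And>z. z \<in> A \<Longrightarrow> g z \<in> W_set (ereal l)" and "0 < l"
  shows "hausdorff_dim A \<le> ereal (1 + 2 / l)"
proof (rule ereal_le_epsilon2)
  fix \<epsilon> :: real assume \<epsilon>: "0 < \<epsilon>"
  have "((\<lambda>\<mu>. 2 / \<mu>) \<longlongrightarrow> 2 / l) (at_left l)"
    using assms(3) by (intro tendsto_intros) auto
  then have "\<forall>\<^sub>F \<mu> in at_left l. 2 / \<mu> < 2 / l + \<epsilon>"
    by (rule order_tendstoD) (use \<epsilon> in auto)
  moreover have "\<forall>\<^sub>F \<mu> in at_left l. \<mu> \<in> {0<..<l}"
    using assms(3) by (intro eventually_at_leftI) auto
  ultimately have "\<forall>\<^sub>F \<mu> in at_left l. 2 / \<mu> < 2 / l + \<epsilon> \<and> \<mu> \<in> {0<..<l}"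
    by eventually_elim auto
  then obtain \<mu> where "2 / \<mu> < 2 / l + \<epsilon>" "0 < \<mu>" "\<mu> < l"
    using eventually_happens'[OF trivial_limit_at_left_real] by force
  then show "hausdorff_dim A \<le> ereal (1 + 2 / l) + ereal \<epsilon>"
    using hausdorff_dim_fibred_over_W_set_le[of g h A "ereal l" \<mu> "1 + 2 / l + \<epsilon>"] assms by simp
qed

lemma hausdorff_dim_W_set_times_le:
  fixes l0 l1 :: real
  assumes "0 < l0" "0 < l1"
  shows "hausdorff_dim (W_set (ereal l0) \<times> W_set (ereal l1)) \<le> ereal (1 + 2 / max l0 l1)"
proof -
  have d: "dist z w \<le> \<bar>fst z - fst w\<bar> + \<bar>snd z - snd w\<bar>" for z w :: "real \<times> real"
    unfolding dist_prod_def dist_real_def by (rule order_trans[OF sqrt_sum_squares_le_sum_abs]) simp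
  then have d': "dist z w \<le> \<bar>snd z - snd w\<bar> + \<bar>fst z - fst w\<bar>" for z w :: "real \<times> real"
    by (simp add: add.commute)
  show ?thesis
    using hausdorff_dim_fibred_over_W_set_le'[of fst snd "W_set (ereal l0) \<times> W_set (ereal l1)" l0, OF d]
      hausdorff_dim_fibred_over_W_set_le'[of snd fst "W_set (ereal l0) \<times> W_set (ereal l1)" l1, OF d']
      assms by (cases "l0 \<le> l1") (auto simp: max_def)
qed

section \<open>Lower bound for the dimension from the set of sums\<close>

text \<open>The sum is 2-Lipschitz, so a cover of \<open>A\<close> by sets \<open>U i\<close> yields
  a cover of the sums by intervals of length \<open>4 * diameter (U i)\<close>. For
  \<open>s < 1\<close> and diameters at most 1 this is at most four times the weight of
  \<open>U i\<close>.\<close>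

lemma hausdorff_dim_ge_1:
  fixes A :: "(real \<times> real) set"
  assumes "\<not> negligible ((\<lambda>(a,b). a + b) ` A)"
  shows "hausdorff_dim A \<ge> 1"
proof (rule ccontr)
  let ?f = "\<lambda>(a::real,b). a + b"
  assume "\<not> hausdorff_dim A \<ge> 1"
  then obtain s where s: "0 \<le> s" "s < 1" "hausdorff_measure s A = 0"
    unfolding hausdorff_dim_def not_le Inf_less_iff by auto
  have p0: "hausdorff_premeasure s 1 A = 0"
  proof -
    have "hausdorff_premeasure s 1 A \<le> hausdorff_measure s A"
      unfolding hausdorff_measure_def by (rule SUP_upper) auto
    then show ?thesis using s by simp
  qed
  have lip: "\<bar>?f z - ?f w\<bar> \<le> 2 * dist z w" for z w
    using dist_fst_le[of z w] dist_snd_le[of z w]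
    by (auto simp: case_prod_beta dist_real_def)
  have "negligible (?f ` A)"
    unfolding negligible_outer_le
  proof (intro allI impI)
    fix e :: real assume e: "e > 0"
    have "hausdorff_premeasure s 1 A < ennreal (e / 4)" using p0 e by simp
    then obtain U :: "nat \<Rightarrow> _" where U: "A \<subseteq> (\<Union>i. U i)"
      "\<And>i. bounded (U i)" "\<And>i. diameter (U i) \<le> 1"
      "(\<Sum>i. diameter_weight s (U i)) < ennreal (e / 4)"
      unfolding hausdorff_premeasure_def Inf_less_iff by auto
    define c where "c i = ?f (SOME z. z \<in> U i)" for i
    define T where "T i = (if U i = {} then {} else cball (c i) (2 * diameter (U i)))" for i
    have fT: "?f ` U i \<subseteq> T i" for i
    proof
      fix y assume "y \<in> ?f ` U i"
      then obtain z where z: "z \<in> U i" "y = ?f z" by blast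
      have "\<bar>c i - y\<bar> \<le> 2 * dist (SOME z. z \<in> U i) z"
        unfolding c_def z(2) by (rule lip)
      also have "dist (SOME z. z \<in> U i) z \<le> diameter (U i)"
        using U(2) someI[of "\<lambda>z. z \<in> U i", OF z(1)] z(1) by (rule diameter_bounded_bound)
      finally show "y \<in> T i" using z by (auto simp: T_def dist_real_def)
    qed
    have mT: "emeasure lborel (T i) \<le> 4 * diameter_weight s (U i)" for i
    proof (cases "U i = {}")
      case False
      have d0: "0 \<le> diameter (U i)" using U by (intro diameter_ge_0)
      \<comment> \<open>For \<open>s = 0\<close> the weight is 1, which also dominates the
        diameter.\<close>
      have "diameter (U i) \<le> diameter (U i) powr s" if "s \<noteq> 0"
        using powr_mono'[of s 1 "diameter (U i)"] d0 U(3)[of i] s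
        by (cases "diameter (U i) = 0") auto
      then have "ennreal (diameter (U i)) \<le> diameter_weight s (U i)"
        using False U(3)[of i] by (auto simp: diameter_weight_def ennreal_le_1 intro: ennreal_leI)
      then have "4 * ennreal (diameter (U i)) \<le> 4 * diameter_weight s (U i)"
        by (rule mult_left_mono) auto
      moreover have "emeasure lborel (T i) = 4 * ennreal (diameter (U i))"
        using False d0 by (simp add: T_def cball_eq_atLeastAtMost ennreal_mult' flip: ennreal_numeral)
      ultimately show ?thesis by simp
    qed (auto simp: T_def)
    have Tm: "T i \<in> sets lborel" for i by (auto simp: T_def)
    have "emeasure lborel (\<Union>i. T i) \<le> (\<Sum>i. emeasure lborel (T i))"
      using Tm by (intro emeasure_subadditive_countably) auto
    also have "\<dots> \<le> (\<Sum>i. 4 * diameter_weight s (U i))"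
      by (intro suminf_le mT) auto
    also have "\<dots> = 4 * (\<Sum>i. diameter_weight s (U i))" by simp
    also have "\<dots> \<le> 4 * ennreal (e / 4)" using U(4) by (intro mult_left_mono) auto
    also have "\<dots> = ennreal e" using e by (simp flip: ennreal_numeral ennreal_mult)
    finally have le: "emeasure lborel (\<Union>i. T i) \<le> ennreal e" .
    then have "emeasure lborel (\<Union>i. T i) < \<infinity>"
      by (auto simp: less_top[symmetric] top_unique)
    then have lm: "(\<Union>i. T i) \<in> fmeasurable lborel"
      using Tm by (intro fmeasurableI) auto
    have "(\<Union>i. T i) \<in> lmeasurable" using lm by (simp add: fmeasurable_def)
    moreover have "measure lebesgue (\<Union>i. T i) \<le> e"
      using le e Tm by (simp add: measure_def enn2real_leI)
    moreover have "?f ` A \<subseteq> (\<Union>i. T i)" using U(1) fT by blast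
    ultimately show "\<exists>T. ?f ` A \<subseteq> T \<and> T \<in> lmeasurable \<and> measure lebesgue T \<le> e" by blast
  qed
  then show False using assms by simp
qed

section \<open>Truncation of binary expansions\<close>

definition trunc :: "nat \<Rightarrow> real \<Rightarrow> real" where
  "trunc k x = of_int \<lfloor>2 ^ k * x\<rfloor> / 2 ^ k"

lemma trunc_le: "trunc k x \<le> x"
  and trunc_gt: "x < trunc k x + 1 / 2 ^ k"
proof -
  have "of_int \<lfloor>2 ^ k * x\<rfloor> \<le> 2 ^ k * x" "2 ^ k * x < of_int \<lfloor>2 ^ k * x\<rfloor> + 1" by linarith+
  then show "trunc k x \<le> x" "x < trunc k x + 1 / 2 ^ k"
    by (simp_all add: trunc_def field_simps)
qed

text \<open>Dyadic points of level \<open>k\<close> are also of level \<open>l\<close>, and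
  \<open>trunc l x\<close> is the largest point of level \<open>l\<close> not exceeding
  \<open>x\<close>.\<close>

lemma trunc_mono_level:
  assumes "k \<le> l"
  shows "trunc k x \<le> trunc l x"
proof -
  have p: "(2::real) ^ l = 2 ^ (l - k) * 2 ^ k" using assms by (simp flip: power_add)
  have "of_int (2 ^ (l - k) * \<lfloor>2 ^ k * x\<rfloor>) = 2 ^ l * trunc k x"
    by (simp add: trunc_def p)
  also have "\<dots> \<le> 2 ^ l * x" using trunc_le by simp
  finally have "2 ^ (l - k) * \<lfloor>2 ^ k * x\<rfloor> \<le> \<lfloor>2 ^ l * x\<rfloor>" by (simp only: le_floor_iff)
  then have "real_of_int (2 ^ (l - k) * \<lfloor>2 ^ k * x\<rfloor>) \<le> of_int \<lfloor>2 ^ l * x\<rfloor>"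
    by (simp only: of_int_le_iff)
  then show ?thesis by (simp add: trunc_def p field_simps)
qed

lemma trunc_trunc:
  assumes "k \<le> l"
  shows "trunc k (trunc l x) = trunc k x"
proof -
  have "\<lfloor>2 ^ k * trunc l x\<rfloor> = \<lfloor>2 ^ k * x\<rfloor>"
  proof (rule antisym)
    show "\<lfloor>2 ^ k * trunc l x\<rfloor> \<le> \<lfloor>2 ^ k * x\<rfloor>" using trunc_le[of l x] by (intro floor_mono) simp
    have "2 ^ k * trunc k x \<le> 2 ^ k * trunc l x" using trunc_mono_level[OF assms, of x] by simp
    then show "\<lfloor>2 ^ k * x\<rfloor> \<le> \<lfloor>2 ^ k * trunc l x\<rfloor>" by (simp add: trunc_def le_floor_iff)
  qed
  then show ?thesis by (simp add: trunc_def)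
qed

lemma trunc_diff_bounds:
  assumes "k \<le> l"
  shows "0 \<le> trunc l x - trunc k x" "trunc l x - trunc k x \<le> 1 / 2 ^ k"
  using trunc_mono_level[OF assms, of x] trunc_le[of l x] trunc_gt[of x k] by linarith+

section \<open>Distribution of digit blocks to two numbers\<close>

text \<open>The \<open>n j\<close> are the block endpoints, and \<open>growth\<close> is the ratio
  bound 9/2 cleared of denominators. The prescribed exponents enter only as hypotheses of later
  lemmas, so finite and infinite exponents share all measure estimates.\<close>

locale sparse_blocks =
  fixes n :: "nat \<Rightarrow> nat"
  assumes n0: "1 \<le> n 0" and growth: "9 * n j \<le> 2 * n (Suc j)"
begin

lemma n_ge_1: "1 \<le> n j"
proof (induction j)
  case (Suc j)
  then show ?case using growth[of j] by linarith
qed (rule n0)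

lemma n_step: "n j + 1 \<le> n (Suc j)"
  using growth[of j] n_ge_1[of j] by linarith

lemma n_add: "n j + i \<le> n (j + i)"
proof (induction i)
  case (Suc i)
  then show ?case using n_step[of "j + i"] by simp
qed simp

lemma n_mono: "i \<le> j \<Longrightarrow> n i \<le> n j"
  using n_add[of i "j - i"] by simp

lemma n_ge: "j \<le> n j"
  using n_add[of 0 j] by simp

text \<open>\<open>part True x\<close> and \<open>part False x\<close> receive alternate blocks of binary digits of \<open>x\<close>.
  The two extra powers of two in a block make the numerators of the partial sums odd and keep
  the tails bounded away from zero, for every \<open>x\<close>.\<close>

definition piece :: "bool \<Rightarrow> nat \<Rightarrow> real \<Rightarrow> real" where
  "piece b i x = (if even i = b
     then trunc (n (Suc i)) x - trunc (n i) x + 1 / 2 ^ n i + 1 / 2 ^ (n (Suc i) + 1) else 0)"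

definition part :: "bool \<Rightarrow> real \<Rightarrow> real" where
  "part b x = (\<Sum>i. piece b i x)"

lemma piece_ge: "even i = b \<Longrightarrow> 1 / 2 ^ n i \<le> piece b i x"
  using add_increasing2[OF _ trunc_diff_bounds(1)[OF n_mono, of i "Suc i" x], of "1 / 2 ^ (n (Suc i) + 1)"]
  by (simp add: piece_def)

lemma piece_nonneg: "0 \<le> piece b i x"
  using order_trans[OF _ piece_ge[of i b x], of 0] by (cases "even i = b") (auto simp: piece_def)

lemma piece_le: "piece b i x \<le> 3 / 2 ^ n i"
proof -
  have "(1::real) / 2 ^ (n (Suc i) + 1) \<le> 1 / 2 ^ n i"
    using n_mono[of i "Suc i"] by (intro divide_left_mono power_increasing) auto
  then show ?thesis
    using trunc_diff_bounds(2)[OF n_mono, of i "Suc i" x]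
    by (auto simp: piece_def)
qed

text \<open>Endpoints increase by at least 1 per block, so the tail from block \<open>j\<close> on
  is dominated by a geometric series.\<close>

lemma piece_shift_le: "piece b (i + j) x \<le> 3 / 2 ^ n j * (1 / 2) ^ i"
proof -
  have "piece b (i + j) x \<le> 3 / 2 ^ n (i + j)" by (rule piece_le)
  also have "\<dots> \<le> 3 / 2 ^ (n j + i)"
    using n_add[of j i] by (intro divide_left_mono power_increasing) (auto simp: add.commute)
  finally show ?thesis by (simp add: power_add power_divide)
qed

lemma summable_piece_shift: "summable (\<lambda>i. piece b (i + j) x)"
proof (rule summable_comparison_test'[where N = 0])
  show "summable (\<lambda>i. 3 / 2 ^ n j * (1 / 2 :: real) ^ i)" by (intro summable_mult summable_geometric) simp
  show "norm (piece b (i + j) x) \<le> 3 / 2 ^ n j * (1 / 2) ^ i" for i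
    using piece_shift_le piece_nonneg by simp
qed

lemma summable_piece: "summable (\<lambda>i. piece b i x)"
  using summable_piece_shift[of b 0] by simp

lemma tail_nonneg: "0 \<le> (\<Sum>i. piece b (i + j) x)"
  by (intro suminf_nonneg summable_piece_shift piece_nonneg)

lemma tail_le: "(\<Sum>i. piece b (i + j) x) \<le> 6 / 2 ^ n j"
proof -
  have "(\<Sum>i. piece b (i + j) x) \<le> (\<Sum>i. 3 / 2 ^ n j * (1 / 2) ^ i)"
    by (intro suminf_le summable_piece_shift piece_shift_le summable_mult summable_geometric) simp
  also have "\<dots> = 3 / 2 ^ n j * (\<Sum>i. (1 / 2) ^ i)"
    by (intro suminf_mult summable_geometric) simp
  also have "\<dots> = 6 / 2 ^ n j" by (simp add: suminf_geometric)
  finally show ?thesis .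
qed

lemma part_split: "part b x = (\<Sum>i<j. piece b i x) + (\<Sum>i. piece b (i + j) x)"
  unfolding part_def using suminf_split_initial_segment[OF summable_piece, of b x j] by simp

lemma part_bounds: "0 \<le> part b x" "part b x \<le> 6"
proof -
  have "(6::real) / 2 ^ n 0 \<le> 6 / 1" by (intro divide_left_mono) auto
  then show "0 \<le> part b x" "part b x \<le> 6"
    using tail_nonneg[of b 0 x] tail_le[of b 0 x] by (simp_all add: part_def)
qed

text \<open>Block \<open>j\<close> belongs to \<open>b\<close>: its extra summand
  \<open>1 / 2 ^ n j\<close> gives the lower bound, the geometric tail the upper one. The upper
  bound makes the truncation a good approximation, the lower one keeps it from being a better
  one.\<close>

lemma part_minus_head:
  assumes "even j = b"
  shows "1 / 2 ^ n j \<le> part b x - (\<Sum>i<j. piece b i x)"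
    and "part b x - (\<Sum>i<j. piece b i x) \<le> 6 / 2 ^ n j"
proof -
  have "1 / 2 ^ n j \<le> piece b (0 + j) x" using piece_ge assms by simp
  also have "\<dots> = (\<Sum>i<1. piece b (i + j) x)" by simp
  also have "\<dots> \<le> (\<Sum>i. piece b (i + j) x)"
    by (intro sum_le_suminf summable_piece_shift) (auto intro: piece_nonneg)
  finally show "1 / 2 ^ n j \<le> part b x - (\<Sum>i<j. piece b i x)"
    using part_split[of b x j] by simp
  show "part b x - (\<Sum>i<j. piece b i x) \<le> 6 / 2 ^ n j"
    using part_split[of b x j] tail_le[of b j x] by simp
qed

text \<open>The summand \<open>1 / 2 ^ (n (Suc j) + 1)\<close> is half a unit in the last digit,
  hence the odd numerator.\<close>

lemma piece_dyadic:
  assumes "even j = b"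
  shows "\<exists>P::int. odd P \<and> piece b j x = P / 2 ^ (n (Suc j) + 1)"
proof -
  define d where "d = n (Suc j) - n j"
  have p: "(2::real) ^ n (Suc j) = 2 ^ d * 2 ^ n j"
    using n_mono[of j "Suc j"] by (simp add: d_def flip: power_add)
  have "piece b j x = of_int (2 * (\<lfloor>2 ^ n (Suc j) * x\<rfloor> - 2 ^ d * \<lfloor>2 ^ n j * x\<rfloor> + 2 ^ d) + 1) / 2 ^ (n (Suc j) + 1)"
    using assms by (simp add: piece_def trunc_def p field_simps)
  then show ?thesis by (metis odd_two_times_div_two_succ even_mult_iff even_numeral even_plus_one_iff)
qed

lemma head_dyadic: "\<exists>P::int. (\<Sum>i<j. piece b i x) = P / 2 ^ (n j + 1)"
proof (induction j)
  case 0
  show ?case by (intro exI[of _ 0]) simp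
next
  case (Suc j)
  then obtain P :: int where P: "(\<Sum>i<j. piece b i x) = P / 2 ^ (n j + 1)" by blast
  obtain R :: int where R: "piece b j x = R / 2 ^ (n (Suc j) + 1)"
  proof (cases "even j = b")
    case True
    then show ?thesis using piece_dyadic that by blast
  next
    case False
    then show ?thesis using that[of 0] by (simp add: piece_def)
  qed
  define d where "d = n (Suc j) - n j"
  have p: "(2::real) ^ n (Suc j) = 2 ^ d * 2 ^ n j"
    using n_mono[of j "Suc j"] by (simp add: d_def flip: power_add)
  have "(\<Sum>i<Suc j. piece b i x) = of_int (2 ^ d * P + R) / 2 ^ (n (Suc j) + 1)"
    using P R by (simp add: p field_simps)
  then show ?case by blast
qed

text \<open>The piece \<open>Suc j\<close> is 0 for \<open>b\<close>, so block \<open>j\<close> is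
  the last to contribute; over the common denominator the earlier ones add an even number. The
  truncation is thus a reduced fraction with known denominator.\<close>

lemma head_odd_dyadic:
  assumes "even j = b"
  shows "\<exists>P::int. odd P \<and> (\<Sum>i<j + 2. piece b i x) = P / 2 ^ (n (Suc j) + 1)"
proof -
  obtain P :: int where P: "(\<Sum>i<j. piece b i x) = P / 2 ^ (n j + 1)" using head_dyadic by blast
  obtain R :: int where R: "odd R" "piece b j x = R / 2 ^ (n (Suc j) + 1)"
    using piece_dyadic assms by blast
  define d where "d = n (Suc j) - n j"
  have d: "d \<noteq> 0" using n_step[of j] by (simp add: d_def)
  have p: "(2::real) ^ n (Suc j) = 2 ^ d * 2 ^ n j"
    using n_mono[of j "Suc j"] by (simp add: d_def flip: power_add)
  have "piece b (Suc j) x = 0" using assms by (auto simp: piece_def)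
  then have "(\<Sum>i<j + 2. piece b i x) = of_int (2 ^ d * P + R) / 2 ^ (n (Suc j) + 1)"
    using P R by (simp add: p field_simps)
  moreover have "odd (2 ^ d * P + R)" using d R by simp
  ultimately show ?thesis by blast
qed

lemma trunc_tendsto: "(\<lambda>i. trunc (n i) x) \<longlonglongrightarrow> x"
proof (rule tendsto_sandwich[where f = "\<lambda>i. x - 1 / 2 ^ i" and h = "\<lambda>i. x"])
  have "x - 1 / 2 ^ i \<le> trunc (n i) x" for i
  proof -
    have "(1::real) / 2 ^ n i \<le> 1 / 2 ^ i"
      using n_ge[of i] by (intro divide_left_mono power_increasing) auto
    then show ?thesis using trunc_gt[of x "n i"] by linarith
  qed
  then show "\<forall>\<^sub>F i in sequentially. x - 1 / 2 ^ i \<le> trunc (n i) x" by simp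
  have "(\<lambda>i. x - (1 / 2) ^ i) \<longlonglongrightarrow> x - 0" by (intro tendsto_diff tendsto_const LIMSEQ_power_zero) simp
  then show "(\<lambda>i. x - 1 / 2 ^ i) \<longlonglongrightarrow> x" by (simp add: power_divide)
qed (simp_all add: trunc_le)

text \<open>Every block goes to exactly one of the numbers, so the truncation differences telescope,
  and the extra powers of two sum to a constant.\<close>

lemma part_add_part: "\<exists>\<kappa>. \<forall>x. part True x + part False x = x - trunc (n 0) x + \<kappa>"
proof -
  define u :: "nat \<Rightarrow> real" where "u i = 1 / 2 ^ n i + 1 / 2 ^ (n (Suc i) + 1)" for i
  have "part True x + part False x = x - trunc (n 0) x + suminf u" for x
  proof -
    have tel: "(\<lambda>i. trunc (n (Suc i)) x - trunc (n i) x) sums (x - trunc (n 0) x)"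
      by (rule telescope_sums[OF trunc_tendsto])
    have eq: "piece True i x + piece False i x - (trunc (n (Suc i)) x - trunc (n i) x) = u i" for i
      by (simp add: piece_def u_def)
    have s: "(\<lambda>i. piece True i x + piece False i x) sums (part True x + part False x)"
      unfolding part_def by (intro sums_add summable_sums summable_piece)
    from sums_diff[OF s tel] have "u sums (part True x + part False x - (x - trunc (n 0) x))"
      unfolding eq .
    then show ?thesis by (simp add: sums_iff)
  qed
  then show ?thesis by blast
qed

text \<open>Within a cell of level \<open>n j\<close> the earlier pieces are constant, and block
  \<open>j\<close> copies the digits up to level \<open>n (Suc j)\<close>. Of the constant 7, 6
  comes from the tails and 1 from truncating \<open>x\<close> and \<open>y\<close>.\<close>

lemma part_local_isometry:
  assumes b: "even j = b" and eq: "trunc (n j) x = trunc (n j) y"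
  shows "\<bar>part b x - part b y - (x - y)\<bar> \<le> 7 / 2 ^ n (Suc j)"
proof -
  have t: "trunc (n i) x = trunc (n i) y" if "i \<le> j" for i
    using trunc_trunc[OF n_mono[OF that], of x] trunc_trunc[OF n_mono[OF that], of y] eq by simp
  have h: "(\<Sum>i<j. piece b i x) = (\<Sum>i<j. piece b i y)"
    by (intro sum.cong) (auto simp: piece_def t)
  have p: "piece b j x - piece b j y = trunc (n (Suc j)) x - trunc (n (Suc j)) y"
    using b eq by (simp add: piece_def)
  have "part b x - part b y = (trunc (n (Suc j)) x - trunc (n (Suc j)) y) +
      ((\<Sum>i. piece b (i + Suc j) x) - (\<Sum>i. piece b (i + Suc j) y))"
    using h p unfolding part_split[of b _ "Suc j"] by simp
  moreover have "\<bar>(\<Sum>i. piece b (i + Suc j) x) - (\<Sum>i. piece b (i + Suc j) y)\<bar> \<le> 6 / 2 ^ n (Suc j)"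
    using tail_le[of b "Suc j" x] tail_nonneg[of b "Suc j" x]
      tail_le[of b "Suc j" y] tail_nonneg[of b "Suc j" y] by linarith
  moreover have "\<bar>trunc (n (Suc j)) x - trunc (n (Suc j)) y - (x - y)\<bar> \<le> 1 / 2 ^ n (Suc j)"
    using trunc_le[of "n (Suc j)" x] trunc_gt[of x "n (Suc j)"]
      trunc_le[of "n (Suc j)" y] trunc_gt[of y "n (Suc j)"] by linarith
  moreover have "(7::real) / 2 ^ n (Suc j) = 6 / 2 ^ n (Suc j) + 1 / 2 ^ n (Suc j)"
    by (simp flip: add_divide_distrib)
  ultimately show ?thesis by linarith
qed

section \<open>Exceptional denominators and Borel-Cantelli\<close>

text \<open>For \<open>i > 0\<close> and \<open>even (Suc i) = b\<close>, two consecutive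
  truncations of \<open>part b x\<close> have denominators \<open>2 ^ (n i + 1)\<close> and
  \<open>2 ^ (n (i + 2) + 1)\<close>. The window holds the \<open>s\<close> too large for comparison
  with the first and too small for comparison with the second. The exponent 7/2 is 9/2 - 1, because
  distinct fractions with denominators \<open>s\<close> and \<open>Q\<close> are at least
  \<open>1 / (s * Q)\<close> apart.\<close>

definition window :: "nat \<Rightarrow> nat set" where
  "window i = {s. 1 \<le> s \<and> 2 ^ n (Suc i) \<le> 64 * real s * 2 ^ n i \<and>
     real s powr (7/2) < 64 * 2 ^ n (i + 2)}"

text \<open>The parity condition selects the levels where block \<open>Suc i\<close> belongs to
  \<open>b\<close>, so that \<open>part_local_isometry\<close> applies to cells of level
  \<open>n (Suc i)\<close>.\<close>

definition bad :: "bool \<Rightarrow> nat \<Rightarrow> real set" where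
  "bad b i = {x \<in> {0..<1}. even (Suc i) = b \<and>
     (\<exists>s\<in>window i. \<exists>p::int. \<bar>part b x - p / s\<bar> \<le> real s powr (-9/2))}"

lemma window_le:
  assumes "s \<in> window i"
  shows "real s \<le> 2 powr ((real (n (i + 2)) + 6) * (2/7))"
proof -
  from assms have s: "1 \<le> s" and w: "real s powr (7/2) < 64 * 2 ^ n (i + 2)"
    by (auto simp: window_def)
  have "real s = (real s powr (7/2)) powr (2/7)" using s by (simp add: powr_powr)
  also have "\<dots> \<le> (64 * 2 ^ n (i + 2)) powr (2/7)" using w by (intro powr_mono2) auto
  also have "(64 :: real) * 2 ^ n (i + 2) = 2 powr (real (n (i + 2)) + 6)"
    by (simp add: powr_add powr_realpow)
  finally show ?thesis by (simp add: powr_powr)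
qed

lemma window_ge:
  assumes "s \<in> window i"
  shows "2 powr (7/9 * real (n (Suc i)) - 6) \<le> real s"
proof -
  from assms have w: "2 ^ n (Suc i) \<le> 64 * real s * 2 ^ n i" by (auto simp: window_def)
  have "real (n i) \<le> 2/9 * n (Suc i)" using growth[of i] by simp
  then have "2 powr (7/9 * real (n (Suc i)) - 6) \<le> (2::real) powr (real (n (Suc i)) - real (n i) - 6)"
    by (intro powr_mono) auto
  also have "\<dots> = 2 ^ n (Suc i) / 2 ^ n i / 64" by (simp add: powr_diff powr_realpow)
  also have "\<dots> \<le> real s" using w by (simp add: field_simps)
  finally show ?thesis .
qed

lemma finite_window: "finite (window i)"
proof -
  define c :: nat where "c = nat \<lceil>2 powr ((real (n (i + 2)) + 6) * (2/7))\<rceil>"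
  have "window i \<subseteq> {..c}"
  proof
    fix s assume "s \<in> window i"
    from window_le[OF this] show "s \<in> {..c}" unfolding c_def by simp linarith
  qed
  then show ?thesis by (rule finite_subset) simp
qed

lemma card_window_le: "real (card (window i)) \<le> 2 powr ((real (n (i + 2)) + 6) * (2/7))"
proof -
  define c :: nat where "c = nat \<lfloor>2 powr ((real (n (i + 2)) + 6) * (2/7))\<rfloor>"
  have "window i \<subseteq> {1..c}"
  proof
    fix s assume s: "s \<in> window i"
    from window_le[OF s] have "s \<le> c" unfolding c_def by linarith
    then show "s \<in> {1..c}" using s by (auto simp: window_def)
  qed
  then have "card (window i) \<le> c" using card_mono[of "{1..c}"] by fastforce
  moreover have "real c \<le> 2 powr ((real (n (i + 2)) + 6) * (2/7))"
    unfolding c_def by simp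
  ultimately show ?thesis by linarith
qed

text \<open>Two points of the set share a cell and have values of \<open>part b\<close> within
  \<open>2 * \<rho>\<close> of each other, so any of its points can serve as centre.\<close>

lemma bad_cell_subset_cball:
  assumes "even (Suc i) = b"
  shows "\<exists>z. {x. \<lfloor>2 ^ n (Suc i) * x\<rfloor> = D \<and> \<bar>part b x - y\<bar> \<le> \<rho>} \<subseteq> cball z (2 * \<rho> + 7 / 2 ^ n (i + 2))"
    (is "\<exists>z. ?A \<subseteq> _")
proof (cases "?A = {}")
  case False
  then obtain z where z: "z \<in> ?A" by blast
  have "?A \<subseteq> cball z (2 * \<rho> + 7 / 2 ^ n (i + 2))"
  proof
    fix x assume x: "x \<in> ?A"
    then have "trunc (n (Suc i)) x = trunc (n (Suc i)) z" using z by (simp add: trunc_def)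
    from part_local_isometry[OF assms this]
    have "\<bar>part b x - part b z - (x - z)\<bar> \<le> 7 / 2 ^ n (i + 2)" by simp
    then have "\<bar>z - x\<bar> \<le> 2 * \<rho> + 7 / 2 ^ n (i + 2)"
      using x z unfolding mem_Collect_eq by linarith
    then show "x \<in> cball z (2 * \<rho> + 7 / 2 ^ n (i + 2))"
      by (simp add: dist_real_def)
  qed
  then show ?thesis by blast
qed auto

text \<open>A union bound over denominators, numerators and cells. In the first term
  \<open>s powr (-7/2)\<close> splits into the summable \<open>s powr (-2)\<close> and
  \<open>s powr (-3/2)\<close>, which by \<open>window_ge\<close> beats the number of cells. In the
  second, both the number and the size of the \<open>s\<close> are at most
  \<open>2 powr ((N' + 6) * (2/7))\<close>, so the factor \<open>2 powr (- N')\<close> wins.\<close>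

lemma sum_window_le:
  "(\<Sum>s\<in>window i. (9 * real s) * 2 ^ n (Suc i) * (2 * (2 * real s powr (-9/2) + 7 / 2 ^ n (i + 2))))
     \<le> (18432 * (\<Sum>s. 1 / real s ^ 2) + 2016) * (2 powr (-1/6)) ^ i"
proof -
  define N where "N = real (n (Suc i))"
  define N' where "N' = real (n (i + 2))"
  have NN': "9 * N \<le> 2 * N'" using growth[of "Suc i"] by (simp add: N_def N'_def)
  have Ni: "real i \<le> N" "1 \<le> N" using n_ge[of "Suc i"] n_ge_1[of "Suc i"] by (simp_all add: N_def)
  have pN: "(2::real) ^ n (Suc i) = 2 powr N" "(2::real) ^ n (i + 2) = 2 powr N'"
    by (simp_all add: N_def N'_def powr_realpow)
  have sm: "summable (\<lambda>s. 1 / real s ^ 2)"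
    using inverse_power_summable[of 2, where 'a = real] by (simp add: field_simps)
  have t: "(9 * real s) * 2 powr N * (2 * (2 * real s powr (-9/2) + 7 / 2 powr N'))
     \<le> 36 * 2 powr (9 - N / 6) * (1 / real s ^ 2) + 126 * 2 powr (N - N' + (N' + 6) * (2/7))"
    if s: "s \<in> window i" for s
  proof -
    have s1: "1 \<le> s" using s by (simp add: window_def)
    have "real s powr (-3/2) \<le> (2 powr (7/9 * N - 6)) powr (-3/2)"
      using window_ge[OF s] by (intro powr_mono2') (auto simp: N_def)
    then have a: "real s powr (-3/2) \<le> 2 powr (9 - 7/6 * N)"
      by (simp add: powr_powr algebra_simps)
    have e: "real s * real s powr (-9/2) = 1 / real s ^ 2 * real s powr (-3/2)"
    proof -
      have "real s * real s powr (-9/2) = real s powr (1 + (-9/2))"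
        using s1 by (subst powr_add) simp
      also have "\<dots> = real s powr (-2 + (-3/2))" by simp
      also have "\<dots> = real s powr (-2) * real s powr (-3/2)" by (rule powr_add)
      also have "real s powr (-2) = 1 / real s ^ 2"
        using s1 by (simp add: powr_minus powr_numeral divide_inverse)
      finally show ?thesis .
    qed
    have "2 powr N * (real s * real s powr (-9/2)) \<le> 2 powr N * (1 / real s ^ 2 * 2 powr (9 - 7/6 * N))"
      unfolding e by (intro mult_left_mono a) auto
    also have "\<dots> = 2 powr (9 - N / 6) * (1 / real s ^ 2)"
    proof -
      have "2 powr N * 2 powr (9 - 7/6 * N) = (2::real) powr (9 - N / 6)"
        unfolding powr_add[symmetric] by (simp add: field_simps)
      then show ?thesis by (simp add: mult_ac)
    qed
    finally have 1: "2 powr N * (real s * real s powr (-9/2)) \<le> 2 powr (9 - N / 6) * (1 / real s ^ 2)" .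
    have "real s * (2 powr N / 2 powr N') \<le> 2 powr ((N' + 6) * (2/7)) * (2 powr N / 2 powr N')"
      using window_le[OF s] by (intro mult_right_mono) (auto simp: N'_def)
    also have "\<dots> = 2 powr (N - N' + (N' + 6) * (2/7))" by (simp add: powr_add powr_diff)
    finally have 2: "real s * (2 powr N / 2 powr N') \<le> 2 powr (N - N' + (N' + 6) * (2/7))" .
    have "(9 * real s) * 2 powr N * (2 * (2 * real s powr (-9/2) + 7 / 2 powr N'))
       = 36 * (2 powr N * (real s * real s powr (-9/2))) + 126 * (real s * (2 powr N / 2 powr N'))"
      by (simp add: algebra_simps)
    then show ?thesis using 1 2 by linarith
  qed
  have "(\<Sum>s\<in>window i. (9 * real s) * 2 ^ n (Suc i) * (2 * (2 * real s powr (-9/2) + 7 / 2 ^ n (i + 2))))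
     \<le> (\<Sum>s\<in>window i. 36 * 2 powr (9 - N / 6) * (1 / real s ^ 2) + 126 * 2 powr (N - N' + (N' + 6) * (2/7)))"
    unfolding pN by (intro sum_mono t)
  also have "\<dots> = 36 * 2 powr (9 - N / 6) * (\<Sum>s\<in>window i. 1 / real s ^ 2)
      + 126 * (real (card (window i)) * 2 powr (N - N' + (N' + 6) * (2/7)))"
    by (simp add: sum.distrib sum_distrib_left)
  also have "\<dots> \<le> 36 * 2 powr (9 - N / 6) * (\<Sum>s. 1 / real s ^ 2) + 126 * (16 * 2 powr (- N / 6))"
  proof (intro add_mono mult_left_mono)
    show "(\<Sum>s\<in>window i. 1 / real s ^ 2) \<le> (\<Sum>s. 1 / real s ^ 2)"
      by (intro sum_le_suminf sm finite_window) auto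
    have "real (card (window i)) * 2 powr (N - N' + (N' + 6) * (2/7))
        \<le> 2 powr ((N' + 6) * (2/7)) * 2 powr (N - N' + (N' + 6) * (2/7))"
      using card_window_le[of i] by (intro mult_right_mono) (auto simp: N'_def)
    also have "\<dots> = 2 powr ((N' + 6) * (2/7) + (N - N' + (N' + 6) * (2/7)))"
      by (rule powr_add[symmetric])
    \<comment> \<open>The exponent is \<open>N - 3/7 * N' + 24/7\<close>, at most
      \<open>24/7 - 13/14 * N\<close> by \<open>NN'\<close>.\<close>
    also have "\<dots> \<le> 2 powr (4 + - N / 6)"
      using NN' Ni by (intro powr_mono) (auto simp: field_simps)
    also have "\<dots> = 16 * 2 powr (- N / 6)" by (subst powr_add) simp
    finally show "real (card (window i)) * 2 powr (N - N' + (N' + 6) * (2/7)) \<le> 16 * 2 powr (- N / 6)" .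
  qed auto
  also have "2 powr (9 - N / 6) = 512 * 2 powr (- N / 6)"
  proof -
    have "2 powr (9 - N / 6) = (2::real) powr (9 + - N / 6)" by simp
    then show ?thesis by (subst (asm) powr_add) simp
  qed
  also have "36 * (512 * 2 powr (- N / 6)) * (\<Sum>s. 1 / real s ^ 2) + 126 * (16 * 2 powr (- N / 6))
      = (18432 * (\<Sum>s. 1 / real s ^ 2) + 2016) * 2 powr (- N / 6)"
    by (simp add: algebra_simps)
  also have "\<dots> \<le> (18432 * (\<Sum>s. 1 / real s ^ 2) + 2016) * (2 powr (-1/6)) ^ i"
  proof (intro mult_left_mono)
    have "(2::real) powr (- N / 6) \<le> 2 powr (-1/6 * real i)" using Ni by (intro powr_mono) auto
    also have "\<dots> = (2 powr (-1/6)) powr real i" by (simp only: powr_powr)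
    also have "\<dots> = (2 powr (-1/6)) ^ i" by (simp add: powr_realpow)
    finally show "(2::real) powr (- N / 6) \<le> (2 powr (-1/6)) ^ i" .
    show "0 \<le> 18432 * (\<Sum>s. 1 / real s ^ 2) + 2016"
      using suminf_nonneg[OF sm] by simp
  qed
  finally show ?thesis .
qed

text \<open>Covering by finitely many closed intervals avoids the question whether
  \<open>bad b i\<close> is measurable.\<close>

lemma bad_cover:
  "\<exists>T \<in> sets lborel. bad b i \<subseteq> T \<and>
     emeasure lborel T \<le> ennreal ((18432 * (\<Sum>s. 1 / real s ^ 2) + 2016) * (2 powr (-1/6)) ^ i)"
proof (cases "even (Suc i) = b")
  case True
  define r where "r s = 2 * real s powr (-9/2) + 7 / 2 ^ n (i + 2)" for s :: nat
  have r0: "0 \<le> r s" for s by (simp add: r_def)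
  define cell where "cell s p D = {x. \<lfloor>2 ^ n (Suc i) * x\<rfloor> = D \<and>
      \<bar>part b x - p / s\<bar> \<le> real s powr (-9/2)}" for s :: nat and p :: int and D :: int
  define z where "z s p D = (SOME w. cell s p D \<subseteq> cball w (r s))" for s p D
  have z: "cell s p D \<subseteq> cball (z s p D) (r s)" for s p D
    unfolding z_def by (rule someI_ex) (use bad_cell_subset_cball[OF True] in \<open>simp add: cell_def r_def\<close>)
  \<comment> \<open>As \<open>part b x\<close> lies between 0 and 6 and the error is at most 1,
    numerators run from \<open>-s\<close> to \<open>7 * s\<close>; the last component lists the
    cells of the unit interval.\<close>
  define I where "I = (SIGMA s:window i. {-int s..7 * int s} \<times> {0..<2 ^ n (Suc i) :: int})"
  have finI: "finite I" unfolding I_def using finite_window by auto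
  define T where "T = (\<Union>(s,p,D)\<in>I. cball (z s p D) (r s))"
  have sub: "bad b i \<subseteq> T"
  proof
    fix x assume "x \<in> bad b i"
    then obtain s and p :: int where x: "0 \<le> x" "x < 1" and s: "s \<in> window i"
      and p: "\<bar>part b x - p / s\<bar> \<le> real s powr (-9/2)" by (auto simp: bad_def)
    have s1: "1 \<le> s" using s by (simp add: window_def)
    have "real s powr (-9/2) \<le> 1 powr (-9/2)" using s1 by (intro powr_mono2') auto
    then have "-1 \<le> p / s" "p / s \<le> 7" using p part_bounds[of b x] by auto
    then have "real_of_int (-int s) \<le> p" "p \<le> real_of_int (7 * int s)"
      using s1 by (auto simp: field_simps)
    then have pI: "p \<in> {-int s..7 * int s}" by (simp only: of_int_le_iff atLeastAtMost_iff)
    have "\<lfloor>2 ^ n (Suc i) * x\<rfloor> \<in> {0..<2 ^ n (Suc i)}" using x by (auto simp: floor_less_iff)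
    then have "(s, p, \<lfloor>2 ^ n (Suc i) * x\<rfloor>) \<in> I" using s pI by (simp add: I_def)
    moreover have "x \<in> cball (z s p \<lfloor>2 ^ n (Suc i) * x\<rfloor>) (r s)"
      using z[of s p "\<lfloor>2 ^ n (Suc i) * x\<rfloor>"] p by (auto simp: cell_def)
    ultimately show "x \<in> T" unfolding T_def by blast
  qed
  have "emeasure lborel T \<le> (\<Sum>(s,p,D)\<in>I. emeasure lborel (cball (z s p D) (r s)))"
    unfolding T_def case_prod_beta by (intro emeasure_subadditive_finite finI) auto
  also have "\<dots> = (\<Sum>(s,p,D)\<in>I. ennreal (2 * r s))"
    using r0 by (simp add: cball_eq_atLeastAtMost)
  also have "\<dots> = ennreal (\<Sum>(s,p,D)\<in>I. 2 * r s)"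
    using r0 by (simp add: case_prod_beta sum_ennreal)
  also have "(\<Sum>(s,p,D)\<in>I. 2 * r s) = (\<Sum>s\<in>window i. \<Sum>y\<in>{-int s..7 * int s} \<times> {0..<2 ^ n (Suc i) :: int}. 2 * r s)"
    unfolding I_def by (subst sum.Sigma[symmetric]) (auto simp: finite_window case_prod_beta)
  also have "\<dots> = (\<Sum>s\<in>window i. (8 * real s + 1) * 2 ^ n (Suc i) * (2 * r s))"
    by (simp add: card_cartesian_product nat_add_distrib algebra_simps)
  also have "\<dots> \<le> (\<Sum>s\<in>window i. (9 * real s) * 2 ^ n (Suc i) * (2 * r s))"
    using r0 by (intro sum_mono mult_right_mono) (auto simp: window_def)
  also have "\<dots> \<le> (18432 * (\<Sum>s. 1 / real s ^ 2) + 2016) * (2 powr (-1/6)) ^ i"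
    unfolding r_def by (rule sum_window_le)
  finally have "emeasure lborel T \<le> ennreal ((18432 * (\<Sum>s. 1 / real s ^ 2) + 2016) * (2 powr (-1/6)) ^ i)"
    by (simp add: ennreal_leI)
  moreover have "T \<in> sets lborel" unfolding T_def using finI by (intro sets.finite_UN) auto
  ultimately show ?thesis using sub by blast
next
  case False
  then have "bad b i = {}" by (simp add: bad_def)
  then show ?thesis by (intro bexI[of _ "{}"]) auto
qed

lemma AE_eventually_not_bad: "AE x in lborel. \<forall>\<^sub>F i in sequentially. x \<notin> bad b i"
proof -
  define K where "K = 18432 * (\<Sum>s. 1 / real s ^ 2) + (2016 :: real)"
  obtain T where T: "\<And>i. T i \<in> sets lborel" "\<And>i. bad b i \<subseteq> T i"
    and m: "\<And>i. emeasure lborel (T i) \<le> ennreal (K * (2 powr (-1/6)) ^ i)"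
    using bad_cover[of b] unfolding K_def by metis
  have "AE x in lborel. \<forall>\<^sub>F i in sequentially. x \<in> space lborel - T i"
  proof (rule borel_cantelli_AE1[OF T(1)])
    show "emeasure lborel (T i) < \<infinity>" for i
      using le_less_trans[OF m ennreal_less_top] by simp
    have K0: "0 \<le> K"
      using suminf_nonneg[of "\<lambda>s. 1 / real s ^ 2"] inverse_power_summable[of 2, where 'a = real]
      by (simp add: K_def field_simps)
    show "summable (\<lambda>i. measure lborel (T i))"
    proof (rule summable_comparison_test'[where N = 0])
      have "(2::real) powr (-1/6) < 2 powr 0" by (intro powr_less_mono) auto
      then show "summable (\<lambda>i. K * (2 powr (-1/6)) ^ i)"
        by (intro summable_mult summable_geometric) simp
      show "norm (measure lborel (T i)) \<le> K * (2 powr (-1/6)) ^ i" for i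
        using m[of i] K0 by (simp add: measure_def enn2real_leI)
    qed
  qed
  then show ?thesis
    by eventually_elim (use T(2) in \<open>auto elim!: eventually_mono\<close>)
qed

section \<open>Irrationality exponents of the two numbers\<close>

definition parity_index :: "bool \<Rightarrow> nat \<Rightarrow> nat" where
  "parity_index b k = 2 * k + (if b then 0 else 1)"

lemma even_parity_index: "even (parity_index b k) = b"
  by (simp add: parity_index_def)

lemma parity_index_Suc: "parity_index b (Suc k) = parity_index b k + 2"
  by (simp add: parity_index_def)

lemma parity_index_ge: "k \<le> parity_index b k"
  by (simp add: parity_index_def)

lemma parity_index_mono: "k \<le> k' \<Longrightarrow> parity_index b k \<le> parity_index b k'"
  by (simp add: parity_index_def)

text \<open>A larger \<open>q\<close> lies between two consecutive comparison levels. Being outside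
  the window, it is small enough for \<open>p / q\<close> to coincide with the truncation
  \<open>P / Q\<close>. Then \<open>Q \<le> q\<close>, since \<open>P / Q\<close> is reduced, while
  by \<open>gap\<close> the error of the truncation exceeds \<open>Q powr (- \<mu>)\<close>.\<close>

lemma approximant_denominator_bound:
  fixes p :: int and q :: nat
  assumes x: "x \<in> {0..<1}" and notbad: "\<And>i. i \<ge> I \<Longrightarrow> x \<notin> bad b i" and \<mu>: "9/2 \<le> \<mu>"
    and gap: "\<And>j. even j = b \<Longrightarrow> real (n (j + 2)) < \<mu> * (real (n (j + 1)) + 1)"
    and q: "1 \<le> q" and pq: "\<bar>part b x - p / q\<bar> \<le> real q powr (- \<mu>)"
  shows "real q powr (7/2) < 64 * 2 ^ n (parity_index b I + 1)"
proof (rule ccontr)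
  let ?J = "parity_index b"
  assume "\<not> ?thesis"
  then have big: "64 * 2 ^ n (?J I + 1) \<le> real q powr (7/2)" by simp
  define P where "P k \<longleftrightarrow> real q powr (7/2) < 64 * 2 ^ n (?J k + 1)" for k
  obtain k0 :: nat where k0: "real q powr (7/2) < 2 ^ k0"
    using real_arch_pow[of 2] by auto
  have "k0 \<le> n (?J k0 + 1)"
    using parity_index_ge[of k0 b] n_ge[of "?J k0 + 1"] by linarith
  then have "(2::real) ^ k0 \<le> 2 ^ n (?J k0 + 1)" by (intro power_increasing) auto
  also have "\<dots> \<le> 64 * 2 ^ n (?J k0 + 1)" by simp
  finally have "(2::real) ^ k0 \<le> 64 * 2 ^ n (?J k0 + 1)" .
  then have "P k0" using k0 unfolding P_def by linarith
  \<comment> \<open>Minimality gives the reverse inequality one level earlier, which brackets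
    \<open>real q powr (7/2)\<close>.\<close>
  define k' where "k' = (LEAST k. P k)"
  have Pk': "P k'" unfolding k'_def using \<open>P k0\<close> by (rule LeastI)
  have "k' > I"
  proof (rule ccontr)
    assume "\<not> k' > I"
    then have "n (?J k' + 1) \<le> n (?J I + 1)" by (intro n_mono add_mono parity_index_mono) auto
    then have "(2::real) ^ n (?J k' + 1) \<le> 2 ^ n (?J I + 1)" by (intro power_increasing) auto
    then show False using Pk' big unfolding P_def by linarith
  qed
  then obtain k where k: "k' = Suc k" "k \<ge> I" by (cases k') auto
  have notPk: "\<not> P k" using k not_less_Least[of k P] by (simp add: k'_def)
  define j where "j = ?J k"
  have jb: "even j = b" by (simp add: j_def even_parity_index)
  have jI: "j + 1 \<ge> I" using parity_index_ge[of k b] k by (simp add: j_def)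
  have lo: "64 * 2 ^ n (j + 1) \<le> real q powr (7/2)" using notPk by (simp add: P_def j_def)
  have hi: "real q powr (7/2) < 64 * 2 ^ n (j + 1 + 2)"
    using Pk' by (simp add: P_def j_def k parity_index_Suc)
  have q92: "real q powr (- \<mu>) \<le> real q powr (-9/2)" using q \<mu> by (intro powr_mono) auto
  have "\<bar>part b x - p / q\<bar> \<le> real q powr (-9/2)" using pq q92 by linarith
  then have "x \<in> bad b (j + 1)" if "q \<in> window (j + 1)"
    unfolding bad_def using x jb that by auto
  then have "q \<notin> window (j + 1)" using notbad[OF jI] by blast
  \<comment> \<open>\<open>q\<close> meets the upper condition of the window, so it must violate the
    lower one.\<close>
  then have R: "64 * real q * 2 ^ n (j + 1) < 2 ^ n (j + 2)"
    using q hi by (auto simp: window_def)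
  obtain P :: int where P: "odd P" "(\<Sum>i<j + 2. piece b i x) = P / 2 ^ (n (Suc j) + 1)"
    using head_odd_dyadic[OF jb] by blast
  define Q :: nat where "Q = 2 ^ (n (j + 1) + 1)"
  have Q0: "0 < real Q" by (simp add: Q_def)
  have PQ: "(\<Sum>i<j + 2. piece b i x) = P / Q" using P(2) by (simp add: Q_def)
  have j2: "even (j + 2) = b" using jb by simp
  have l: "1 / 2 ^ n (j + 2) \<le> part b x - P / Q" and u: "part b x - P / Q \<le> 6 / 2 ^ n (j + 2)"
    using part_minus_head[OF j2, of x] unfolding PQ by auto
  have u': "6 / 2 ^ n (j + 2) \<le> 6 / (32 * (real q * Q))"
  proof (rule divide_left_mono)
    show "32 * (real q * Q) \<le> 2 ^ n (j + 2)" using R by (simp add: Q_def)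
  qed (use q Q0 in simp_all)
  have "real q * real q powr (7/2) = real q powr (9/2)" by (simp add: powr_mult_base)
  then have "real q powr (-9/2) = 1 / (real q * real q powr (7/2))"
    using powr_minus_divide[of "real q" "9/2"] by simp
  also have "\<dots> \<le> 1 / (32 * (real q * Q))"
  proof (rule divide_left_mono)
    have "32 * real Q \<le> real q powr (7/2)" using lo by (simp add: Q_def)
    then have "real q * (32 * real Q) \<le> real q * real q powr (7/2)" by (intro mult_left_mono) auto
    then show "32 * (real q * Q) \<le> real q * real q powr (7/2)" by (simp add: mult_ac)
  qed (use q Q0 in simp_all)
  finally have q92': "real q powr (-9/2) \<le> 1 / (32 * (real q * Q))" .
  have "0 \<le> part b x - P / Q" by (rule order_trans[OF _ l]) simp
  moreover have "7 / (32 * (real q * Q)) = 6 / (32 * (real q * Q)) + 1 / (32 * (real q * Q))"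
    unfolding add_divide_distrib[symmetric] by simp
  \<comment> \<open>The truncation error contributes 6/32 and the error of \<open>p / q\<close>
    1/32, together less than the minimal distance of distinct fractions.\<close>
  ultimately have "\<bar>P / Q - p / q\<bar> \<le> 7 / (32 * (real q * Q))"
    using pq q92 q92' u u' by linarith
  also have "\<dots> < 1 / (real q * Q)" using q Q0 by (simp add: field_simps)
  finally have "\<bar>P / Q - p / q\<bar> * (real q * Q) < 1" using q Q0 by (simp add: field_simps)
  moreover have "\<bar>P / Q - p / q\<bar> * (real q * Q) = \<bar>(P / Q - p / q) * (real q * Q)\<bar>"
    using Q0 by (simp add: abs_mult)
  moreover have "(P / Q - p / q) * (real q * Q) = of_int (P * int q - p * int Q)"
    using q Q0 by (simp add: field_simps)
  ultimately have "\<bar>real_of_int (P * int q - p * int Q)\<bar> < 1" by simp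
  then have eq: "P * int q = p * int Q" by linarith
  have "coprime (int Q) P" using P(1) by (simp add: Q_def coprime_commute)
  moreover have "int Q dvd P * int q" unfolding eq by simp
  ultimately have "int Q dvd int q" using coprime_dvd_mult_right_iff by blast
  then have "Q \<le> q" using q by (simp add: dvd_imp_le)
  have "P / Q = p / q" using arg_cong[OF eq, of real_of_int] q Q0 by (simp add: field_simps)
  then have "1 / 2 ^ n (j + 2) \<le> real q powr (- \<mu>)" using pq l by linarith
  also have "\<dots> \<le> real Q powr (- \<mu>)" using \<open>Q \<le> q\<close> Q0 \<mu> by (intro powr_mono2') auto
  also have "real Q = 2 powr (real (n (j + 1)) + 1)" by (simp add: Q_def powr_add powr_realpow)
  also have "\<dots> powr (- \<mu>) = 2 powr (- (\<mu> * (real (n (j + 1)) + 1)))" by (simp add: powr_powr mult.commute)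
  also have "\<dots> < 2 powr (- real (n (j + 2)))" using gap[OF jb] by (intro powr_less_mono) auto
  also have "\<dots> = 1 / 2 ^ n (j + 2)" by (simp add: powr_minus powr_realpow divide_inverse)
  finally show False by simp
qed

lemma finite_approximants_part:
  assumes "x \<in> {0..<1}" "\<forall>\<^sub>F i in sequentially. x \<notin> bad b i" "9/2 \<le> \<mu>"
    and "\<And>j. even j = b \<Longrightarrow> real (n (j + 2)) < \<mu> * (real (n (j + 1)) + 1)"
  shows "finite (approximants \<mu> (part b x))"
proof -
  obtain I where I: "\<And>i. i \<ge> I \<Longrightarrow> x \<notin> bad b i"
    using assms(2) unfolding eventually_sequentially by blast
  show ?thesis
  proof (rule finite_approximants_bounded[where B = "64 * 2 ^ n (parity_index b I + 1)"])
    fix p :: int and q :: nat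
    assume q: "1 \<le> q" "\<bar>part b x - p / q\<bar> \<le> real q powr (- \<mu>)"
    have "real q powr 1 \<le> real q powr (7/2)" using q by (intro powr_mono) auto
    moreover have "real q powr (7/2) < 64 * 2 ^ n (parity_index b I + 1)"
      by (rule approximant_denominator_bound[OF assms(1) _ assms(3) _ q]) (use I assms(4) in auto)
    ultimately have "real q \<le> real (64 * 2 ^ n (parity_index b I + 1))"
      using q by simp
    then show "q \<le> 64 * 2 ^ n (parity_index b I + 1)" by (simp only: of_nat_le_iff)
  qed (use assms in auto)
qed

text \<open>The truncations themselves are the solutions, for every \<open>x\<close>. The summand 3
  absorbs the factor 6 of the error, as \<open>6 \<le> 2 ^ 3\<close>; the summand 1 comes from the
  denominator \<open>2 ^ (n (j + 1) + 1)\<close>.\<close>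

lemma infinite_approximants_part:
  assumes "\<forall>\<^sub>F j in sequentially. even j = b \<longrightarrow> \<mu> * (real (n (j + 1)) + 1) + 3 \<le> real (n (j + 2))"
  shows "infinite (approximants \<mu> (part b x))"
proof
  assume fin: "finite (approximants \<mu> (part b x))"
  obtain K where K: "\<And>j. j \<ge> K \<Longrightarrow> even j = b \<Longrightarrow> \<mu> * (real (n (j + 1)) + 1) + 3 \<le> real (n (j + 2))"
    using assms unfolding eventually_sequentially by blast
  define r where "r k = (\<Sum>i<parity_index b k + 2. piece b i x)" for k
  \<comment> \<open>Approximants are counted as numbers, so the truncations have to be
    distinct.\<close>
  have "strict_mono r"
    unfolding strict_mono_Suc_iff
  proof
    fix k
    define j where "j = parity_index b k + 2"
    have "0 < 1 / (2::real) ^ n j" by simp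
    also have "\<dots> \<le> piece b j x" by (rule piece_ge) (simp add: j_def even_parity_index)
    finally show "r k < r (Suc k)"
      using piece_nonneg[of b "Suc j" x] by (simp add: r_def parity_index_Suc j_def)
  qed
  then have inj: "inj r" by (rule strict_mono_imp_inj_on)
  have "r ` {K..} \<subseteq> approximants \<mu> (part b x)"
  proof clarify
    fix k assume k: "K \<le> k"
    define j where "j = parity_index b k"
    have jb: "even j = b" "even (j + 2) = b" by (simp_all add: j_def even_parity_index)
    have jK: "j \<ge> K" using k parity_index_ge[of k b] by (simp add: j_def)
    obtain P :: int where P: "(\<Sum>i<j + 2. piece b i x) = P / 2 ^ (n (Suc j) + 1)"
      using head_odd_dyadic[OF jb(1)] by blast
    define Q :: nat where "Q = 2 ^ (n (j + 1) + 1)"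
    have PQ: "r k = P / Q" using P by (simp add: Q_def r_def j_def)
    have "0 \<le> 1 / (2::real) ^ n (j + 2)" by simp
    then have "\<bar>part b x - r k\<bar> \<le> 6 / 2 ^ n (j + 2)"
      using part_minus_head[OF jb(2), of x] unfolding r_def j_def[symmetric] by linarith
    also have "\<dots> \<le> 8 / 2 ^ n (j + 2)" by (simp add: divide_right_mono)
    also have "\<dots> = 2 powr (3 - real (n (j + 2)))" by (simp add: powr_diff powr_realpow)
    also have "\<dots> \<le> 2 powr (- (\<mu> * (real (n (j + 1)) + 1)))"
      using K[OF jK jb(1)] by (intro powr_mono) auto
    also have "\<dots> = (2 powr (real (n (j + 1)) + 1)) powr (- \<mu>)" by (simp add: powr_powr mult.commute)
    also have "2 powr (real (n (j + 1)) + 1) = real Q" by (simp add: Q_def powr_add powr_realpow)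
    finally have "\<bar>part b x - r k\<bar> \<le> real Q powr (- \<mu>)" .
    moreover have "1 \<le> Q" by (simp add: Q_def)
    ultimately show "r k \<in> approximants \<mu> (part b x)" using PQ unfolding approximants_def by blast
  qed
  then have "finite (r ` {K..})" using fin finite_subset by blast
  then have "finite {K..}" by (rule finite_imageD) (rule inj_on_subset[OF inj], simp)
  then show False by (simp add: infinite_Ici)
qed

text \<open>Truncations realize every exponent below \<open>l\<close>; outside the bad sets no
  exponent above \<open>l\<close> has infinitely many solutions. For \<open>l = \<infinity>\<close>
  the hypothesis \<open>upper\<close> is vacuous.\<close>

lemma part_in_W_set:
  assumes "x \<in> {0..<1}" "\<forall>\<^sub>F i in sequentially. x \<notin> bad b i" "ereal (9/2) \<le> l"
    and lower: "\<And>\<mu>. ereal \<mu> < l \<Longrightarrow>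
      \<forall>\<^sub>F j in sequentially. even j = b \<longrightarrow> \<mu> * (real (n (j + 1)) + 1) + 3 \<le> real (n (j + 2))"
    and upper: "\<And>\<mu> j. l < ereal \<mu> \<Longrightarrow> even j = b \<Longrightarrow> real (n (j + 2)) < \<mu> * (real (n (j + 1)) + 1)"
  shows "part b x \<in> W_set l"
proof -
  have "Sup {ereal \<mu> | \<mu>. infinite (approximants \<mu> (part b x))} = l"
  proof (rule antisym)
    show "Sup {ereal \<mu> | \<mu>. infinite (approximants \<mu> (part b x))} \<le> l"
    proof (rule Sup_least, clarify, rule ccontr)
      fix \<mu> assume inf: "infinite (approximants \<mu> (part b x))" and "\<not> ereal \<mu> \<le> l"
      then have lm: "l < ereal \<mu>" by simp
      from order_le_less_trans[OF assms(3) lm] have m: "9/2 \<le> \<mu>" by simp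
      have "finite (approximants \<mu> (part b x))"
        by (rule finite_approximants_part[OF assms(1,2) m upper[OF lm]])
      then show False using inf by simp
    qed
    show "l \<le> Sup {ereal \<mu> | \<mu>. infinite (approximants \<mu> (part b x))}"
    proof (rule dense_le)
      fix y assume y: "y < l"
      show "y \<le> Sup {ereal \<mu> | \<mu>. infinite (approximants \<mu> (part b x))}"
      proof (cases y)
        case (real \<mu>)
        then have "infinite (approximants \<mu> (part b x))"
          using y by (intro infinite_approximants_part lower) simp
        then show ?thesis using real by (intro Sup_upper) auto
      qed (use y in auto)
    qed
  qed
  then show ?thesis by (simp add: W_set_def irrationality_exponent_alt)
qed

section \<open>Choice of the block endpoints and the lower bound for products\<close>

lemma hausdorff_dim_W_set_times_ge_1_aux:
  fixes l :: "bool \<Rightarrow> ereal"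
  assumes "\<And>b. ereal (9/2) \<le> l b"
    and "\<And>b \<mu>. ereal \<mu> < l b \<Longrightarrow>
      \<forall>\<^sub>F j in sequentially. even j = b \<longrightarrow> \<mu> * (real (n (j + 1)) + 1) + 3 \<le> real (n (j + 2))"
    and "\<And>b \<mu> j. l b < ereal \<mu> \<Longrightarrow> even j = b \<Longrightarrow> real (n (j + 2)) < \<mu> * (real (n (j + 1)) + 1)"
  shows "1 \<le> hausdorff_dim (W_set (l True) \<times> W_set (l False))"
proof (rule hausdorff_dim_ge_1, rule notI)
  let ?S = "(\<lambda>(a,b). a + b) ` (W_set (l True) \<times> W_set (l False))"
  assume neg: "negligible ?S"
  obtain \<kappa> where \<kappa>: "\<And>x. part True x + part False x = x - trunc (n 0) x + \<kappa>"
    using part_add_part by blast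
  have "AE x in lborel. \<forall>b. \<forall>\<^sub>F i in sequentially. x \<notin> bad b i"
    unfolding all_bool_eq by (intro AE_conjI AE_eventually_not_bad)
  then obtain Z where Z: "{x \<in> space lborel. \<not> (\<forall>b. \<forall>\<^sub>F i in sequentially. x \<notin> bad b i)} \<subseteq> Z"
    "Z \<in> null_sets lborel"
    unfolding eventually_ae_filter by blast
  from Z(2) have "negligible Z"
    by (simp add: negligible_iff_null_sets null_sets_completionI)
  then have "negligible (Z \<union> (+) (- \<kappa>) ` ?S)"
    by (intro negligible_Un negligible_translation neg)
  \<comment> \<open>On this interval \<open>trunc (n 0) x\<close> is 0, so \<open>x\<close> is the
    sum of its parts up to \<open>\<kappa>\<close>.\<close>
  moreover have "box 0 (1 / 2 ^ n 0) \<subseteq> Z \<union> (+) (- \<kappa>) ` ?S"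
  proof
    fix x :: real assume "x \<in> box 0 (1 / 2 ^ n 0)"
    then have x: "0 < x" "x < 1 / 2 ^ n 0" by auto
    have "1 / (2::real) ^ n 0 \<le> 1 / 1" by (intro divide_left_mono) auto
    then have "x < 1" using x by linarith
    then have x1: "x \<in> {0..<1}" using x by simp
    have "0 \<le> 2 ^ n 0 * x" "2 ^ n 0 * x < 1" using x by (auto simp: field_simps)
    then have "\<lfloor>2 ^ n 0 * x\<rfloor> = 0" by linarith
    then have t: "x = - \<kappa> + (part True x + part False x)" using \<kappa>[of x] by (simp add: trunc_def)
    show "x \<in> Z \<union> (+) (- \<kappa>) ` ?S"
    proof (cases "x \<in> Z")
      case False
      then have ev: "\<forall>\<^sub>F i in sequentially. x \<notin> bad b i" for b
        using Z(1) by auto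
      have "part b x \<in> W_set (l b)" for b
        by (rule part_in_W_set[OF x1 ev assms(1) assms(2) assms(3)])
      then have "(part True x, part False x) \<in> W_set (l True) \<times> W_set (l False)" by blast
      then have "part True x + part False x \<in> ?S" by (rule rev_image_eqI) simp
      then show ?thesis using t by blast
    qed simp
  qed
  ultimately have "negligible (box 0 (1 / 2 ^ n 0 :: real))" by (rule negligible_subset)
  moreover have "box 0 (1 / 2 ^ n 0 :: real) \<noteq> {}" by (simp add: box_ne_empty not_le)
  ultimately show False using open_not_negligible open_box by blast
qed

end

text \<open>\<open>L j\<close> prescribes the ratio of \<open>n (Suc j)\<close> to
  \<open>n j\<close>. The exponent of number \<open>b\<close> depends on the ratios across its zero
  blocks, which are the \<open>L (j + 1)\<close> with \<open>even j = b\<close>. In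
  \<open>lower\<close> the room between \<open>\<mu>\<close> and \<open>\<nu>\<close> absorbs the
  additive constants.\<close>

lemma hausdorff_dim_W_set_times_ge_1:
  fixes l :: "bool \<Rightarrow> ereal" and L :: "nat \<Rightarrow> real"
  assumes l: "\<And>b. ereal (9/2) \<le> l b" and L: "\<And>j. 9/2 \<le> L j"
    and lower: "\<And>b \<mu>. ereal \<mu> < l b \<Longrightarrow> \<exists>\<nu>>\<mu>. \<forall>\<^sub>F j in sequentially. even j = b \<longrightarrow> \<nu> \<le> L (j + 1)"
    and upper: "\<And>b \<mu> (j::nat). l b < ereal \<mu> \<Longrightarrow> even j = b \<Longrightarrow> L (j + 1) < \<mu>"
  shows "1 \<le> hausdorff_dim (W_set (l True) \<times> W_set (l False))"
proof -
  define n :: "nat \<Rightarrow> nat" where "n = rec_nat 1 (\<lambda>j m. nat \<lceil>L j * real m\<rceil>)"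
  have n_0: "n 0 = 1" by (simp add: n_def)
  have n_Suc: "n (Suc j) = nat \<lceil>L j * real (n j)\<rceil>" for j by (simp add: n_def)
  have L0: "0 \<le> L j * real (n j)" for j using L[of j] by (intro mult_nonneg_nonneg) auto
  have ge: "L j * real (n j) \<le> real (n (Suc j))" and less: "real (n (Suc j)) < L j * real (n j) + 1" for j
    using L0[of j] unfolding n_Suc by linarith+
  interpret sparse_blocks n
  proof
    show "9 * n j \<le> 2 * n (Suc j)" for j
    proof -
      have "9/2 * real (n j) \<le> L j * real (n j)" using L by (intro mult_right_mono) auto
      then have "9/2 * real (n j) \<le> real (n (Suc j))" using ge[of j] by linarith
      then show ?thesis by linarith
    qed
  qed (simp add: n_0)
  show ?thesis
  proof (rule hausdorff_dim_W_set_times_ge_1_aux[OF l])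
    fix b \<mu> assume "ereal \<mu> < l b"
    from lower[OF this] obtain \<nu> where \<nu>: "\<nu> > \<mu>"
      "\<forall>\<^sub>F j in sequentially. even j = b \<longrightarrow> \<nu> \<le> L (j + 1)" by blast
    have "filterlim (\<lambda>j. (\<nu> - \<mu>) * real j) at_top sequentially"
      using \<nu>(1) by real_asymp
    then have "\<forall>\<^sub>F j in sequentially. \<mu> + 3 \<le> (\<nu> - \<mu>) * real j"
      unfolding filterlim_at_top by blast
    with \<nu>(2) show "\<forall>\<^sub>F j in sequentially. even j = b \<longrightarrow> \<mu> * (real (n (j + 1)) + 1) + 3 \<le> real (n (j + 2))"
    proof eventually_elim
      case (elim j)
      show ?case
      proof
        assume "even j = b"
        then have "\<nu> * real (n (j + 1)) \<le> L (j + 1) * real (n (j + 1))"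
          using elim by (intro mult_right_mono) auto
        then have 1: "\<nu> * real (n (j + 1)) \<le> real (n (j + 2))" using ge[of "j + 1"] by simp
        have "(\<nu> - \<mu>) * real j \<le> (\<nu> - \<mu>) * real (n (j + 1))"
          using \<nu>(1) n_ge[of "j + 1"] by (intro mult_left_mono) auto
        then have "\<mu> + 3 \<le> (\<nu> - \<mu>) * real (n (j + 1))" using elim by linarith
        then show "\<mu> * (real (n (j + 1)) + 1) + 3 \<le> real (n (j + 2))"
          using 1 by (simp add: algebra_simps)
      qed
    qed
  next
    fix b \<mu> and j :: nat assume u: "l b < ereal \<mu>" "even j = b"
    \<comment> \<open>Rounding up costs less than 1, which the extra summand \<open>\<mu>\<close>
      covers.\<close>
    from order_le_less_trans[OF l u(1)] have "9/2 < \<mu>" by simp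
    moreover have "L (j + 1) * real (n (j + 1)) \<le> \<mu> * real (n (j + 1))"
      using upper[OF u] by (intro mult_right_mono) auto
    ultimately show "real (n (j + 2)) < \<mu> * (real (n (j + 1)) + 1)"
      using less[of "j + 1"] by (simp add: algebra_simps)
  qed
qed

theorem theorem3p7:
  shows "(\<forall>l0 l1 :: real. min l0 l1 > (5 + sqrt 17) / 2 \<longrightarrow>
            ereal (1 + 2 / max l0 l1) \<ge> hausdorff_dim (W_set (ereal l0) \<times> W_set (ereal l1)) \<and>
            hausdorff_dim (W_set (ereal l0) \<times> W_set (ereal l1)) \<ge> 1 \<and>
            1 = max 1 (2 / l0 + 2 / l1)) \<and>
         (\<forall>l :: ereal. l > ereal ((5 + sqrt 17) / 2) \<longrightarrow>
            hausdorff_dim (W_set l \<times> W_set l) \<ge> 1 \<and>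
            1 > 2 * hausdorff_dim (W_set l))"
proof -
  \<comment> \<open>Since \<open>sqrt 17 > 4\<close>, the threshold exceeds the constant 9/2 of the
    construction.\<close>
  have "sqrt 16 < sqrt 17" by (rule real_sqrt_less_mono) simp
  then have thr: "9/2 < (5 + sqrt 17) / 2" by simp
  have ge1: "1 \<le> hausdorff_dim (W_set (ereal l0) \<times> W_set (ereal l1))"
    if "9/2 < l0" "9/2 < l1" for l0 l1 :: real
  proof -
    define l where "l b = (if b then l0 else l1)" for b
    have l: "9/2 < l b" for b using that by (simp add: l_def)
    have "1 \<le> hausdorff_dim (W_set (ereal (l True)) \<times> W_set (ereal (l False)))"
    \<comment> \<open>For \<open>even j = b\<close> the ratio at index \<open>j + 1\<close> is
      exactly \<open>l b\<close>.\<close>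
    proof (rule hausdorff_dim_W_set_times_ge_1[where L = "\<lambda>j. l (odd j)" and l = "\<lambda>b. ereal (l b)"])
      show "ereal (9/2) \<le> ereal (l b)" for b using l[of b] by simp
      show "9/2 \<le> l (odd j)" for j using l less_imp_le by blast
      show "\<exists>\<nu>>\<mu>. \<forall>\<^sub>F j in sequentially. even j = b \<longrightarrow> \<nu> \<le> l (odd (j + 1))" if "ereal \<mu> < ereal (l b)" for b \<mu>
        using that by (intro exI[of _ "l b"]) auto
      show "l (odd (j + 1)) < \<mu>" if "ereal (l b) < ereal \<mu>" "even j = b" for b \<mu> and j :: nat
        using that by auto
    qed
    then show ?thesis by (simp add: l_def)
  qed
  have ge1': "1 \<le> hausdorff_dim (W_set \<infinity> \<times> W_set \<infinity>)"
  \<comment> \<open>Ratios tending to infinity give both numbers the exponent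
    \<open>\<infinity>\<close>.\<close>
  proof (rule hausdorff_dim_W_set_times_ge_1[where L = "\<lambda>j. real j + 5" and l = "\<lambda>_. \<infinity>"])
    fix b :: bool and \<mu> :: real
    have "filterlim (\<lambda>j. real (j + 1) + 5) at_top sequentially" by real_asymp
    then have "\<forall>\<^sub>F j in sequentially. \<mu> + 1 \<le> real (j + 1) + 5"
      unfolding filterlim_at_top by blast
    then show "\<exists>\<nu>>\<mu>. \<forall>\<^sub>F j in sequentially. even j = b \<longrightarrow> \<nu> \<le> real (j + 1) + 5"
      by (intro exI[of _ "\<mu> + 1"]) (auto elim: eventually_mono)
  qed auto
  show ?thesis
  proof (intro conjI allI impI)
    fix l0 l1 :: real assume "(5 + sqrt 17) / 2 < min l0 l1"
    then have l: "9/2 < l0" "9/2 < l1" using thr by auto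
    then show "hausdorff_dim (W_set (ereal l0) \<times> W_set (ereal l1)) \<le> ereal (1 + 2 / max l0 l1)"
      by (intro hausdorff_dim_W_set_times_le) auto
    show "1 \<le> hausdorff_dim (W_set (ereal l0) \<times> W_set (ereal l1))" using l by (rule ge1)
    have "2 / l0 \<le> 2 / (9/2)" "2 / l1 \<le> 2 / (9/2)" using l by (intro divide_left_mono; simp)+
    then show "1 = max 1 (2 / l0 + 2 / l1)" by simp
  next
    fix l :: ereal assume "ereal ((5 + sqrt 17) / 2) < l"
    then have l: "ereal (9/2) < l" using thr by (meson ereal_less_eq(3) less_imp_le order_le_less_trans)
    show "1 \<le> hausdorff_dim (W_set l \<times> W_set l)"
      using l ge1 ge1' by (cases l) auto
    \<comment> \<open>9/20 lies strictly between 4/9, which is \<open>2 / \<mu>\<close> for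
      \<open>\<mu> = 9/2\<close>, and 1/2.\<close>
    have "hausdorff_dim (W_set l) \<le> ereal (9/20)"
      by (rule hausdorff_dim_W_set_le[OF l]) auto
    then have "2 * hausdorff_dim (W_set l) \<le> 2 * ereal (9/20)" by (intro ereal_mult_left_mono) auto
    also have "\<dots> < 1" by (simp add: numeral_eq_ereal one_ereal_def)
    finally show "2 * hausdorff_dim (W_set l) < 1" .
  qed
qed

end
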